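(* Let $\mathbb{M}$ be a local Moufang set, with fixed non-equivalent points $0,\infty\in X$, such that (R1) $\mathbb{M}$ is special; (R2) the root group $U_\infty$ is abelian; (R3) the Hua subgroup $H$ is abelian; (R4) if $x$ is a unit, then $x\cdot 2$ is a unit. Fix a unit $e$, let $R=X\setminus\overline{\infty}$ be the local ring and $R_x$ ($x\in R$) the maps constructed from $\mathbb{M}$ and $e$ as in the context. Assume furthermore that $$x\,\mu_e\,\alpha_y = y\,R_x\,\alpha_{-2e}\,\mu_e\,R_x\,\mu_e\qquad\text{for all } x\sim 0 \text{ and } y\nsim\infty .$$ Then $\mathbb{M}$ is isomorphic to the local Moufang set $\mathbb{M}(R)$.
   Context: Conventions: all actions are on the right, $xg$ (or $x\cdot g$) is the image of $x$ under $g$, products are composed left to right, $g^h=h^{-1}gh$. For a set with an equivalence relation $(X,\sim)$, $\overline{x}$ is the class of $x$, $\overline{X}$ is the set of classes, and $\mathrm{Sym}(X,\sim)$ is the group of permutations of $X$ preserving the equivalence relation. Local rings are commutative with $1$. A local Moufang set consists of $(X,\sim)$ with $|\overline{X}|>2$ and subgroups $U_x\le\mathrm{Sym}(X,\sim)$ for $x\in X$ (root groups). Write $U_{\overline{x}}$ for the image of $U_x$ in $\mathrm{Sym}(\overline{X})$ and $G=\langle U_x\mid x\in X\rangle$. The axioms are: (LM1) if $x\sim y$ then $U_{\overline{x}}=U_{\overline{y}}$; (LM2) for $x\in X$, $U_x$ fixes $x$ and acts sharply transitively on $X\setminus\overline{x}$; (LM2') for $\overline{x}\in\overline{X}$, $U_{\overline{x}}$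 fixes $\overline{x}$ and acts sharply transitively on $\overline{X}\setminus\{\overline{x}\}$; (LM3) $U_x^g=U_{xg}$ for all $x\in X$, $g\in G$. Isomorphism: local Moufang sets $\mathbb{M}$ on $(X,\sim)$ and $\mathbb{M}'$ on $(X',\sim')$ are isomorphic if there are a bijection $\varphi:X\to X'$ and group isomorphisms $\theta_x:U_x\to U'_{\varphi(x)}$ ($x\in X$) with $x\sim y\iff\varphi(x)\sim'\varphi(y)$ for all $x,y\in X$, and $\varphi(x\cdot u)=\varphi(x)\cdot\theta_y(u)$ for all $x,y\in X$, $u\in U_y$. Fix $0,\infty\in X$ with $0\nsim\infty$. For $x\nsim\infty$, $\alpha_x$ is the unique element of $U_\infty$ mapping $0$ to $x$, $-x:=0\alpha_x^{-1}$ (so $\alpha_{-x}=\alpha_x^{-1}$), and $x\cdot 2:=0\alpha_x^2$. A unit is an $x\in X$ with $x\nsim0$, $x\nsim\infty$. For a unit $x$, $\mu_x$ is the unique element of the double coset $U_0\alpha_xU_0$ interchanging $0$ and $\infty$ (it exists and is unique); such elements are called $\mu$-maps. The Hua subgroup is $H=\langle\mu_x\mu_y\mid x,y\text{ units}\rangle$. $\mathbb{M}$ is special if $(-x)\tau=-(x\tau)$ for all units $x$, where $\tau$ is a $\mu$-map (the condition does not depend on which $\mu$-map is used). Ring construction (under (R1)--(R4)): put $R:=X\setminus\overline{\infty}$ and $x+y:=0\cdot\alpha_x\alpha_y$ for $x,y\in R$; then $(R,+)$ is an abelian group with neutral element $0$, negation $x\mapsto -x$, and it is uniquely $2$-divisible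 (write $z/2$ for the unique $w$ with $w+w=z$). Fix a unit $e$ and set $h_x:=\mu_e\mu_x$ for units $x$. With $2e=e+e$, for $y\in R$ define $R_y:R\to R$ by $xR_y:=x h_{e+y}-x h_y-x$ if $y$ and $y+e$ are units; $xR_y:=-x h_{-e+y}+x+x h_y$ if $y$ is a unit and $y+e$ is not a unit; $xR_y:=x h_{2e+y}-x h_{e+y}-x h_{-2e}+x$ if $y$ is not a unit (all Hua maps occurring here are indexed by units). The multiplication is $xy:=(xR_y)/2$ for $x,y\in R$. With these operations $R$ is a local ring with identity element $e$, in which $2$ is invertible. $\mathbb{M}(R)$: for a local ring $R$ with maximal ideal $\mathfrak{m}$ and identity $1$, the projective line is $\mathbb{P}^1(R)=\{[a,b]\mid a,b\in R,\ aR+bR=R\}$ with $[a,b]=\{(au,bu)\mid u\in R^\times\}$; so $\mathbb{P}^1(R)=\{[1,r]\mid r\in R\}\cup\{[m,1]\mid m\in\mathfrak{m}\}$. The equivalence is: $[1,r]\sim[1,s]\iff r-s\in\mathfrak{m}$; $[m,1]\sim[n,1]$ for all $m,n\in\mathfrak{m}$; no other equivalences. $\mathrm{PSL}_2(R)=\{A\in\mathrm{Mat}_2(R)\mid\det A=1\}/\{rI\mid r^2=1\}$ acts on $\mathbb{P}^1(R)$ by right multiplication on row vectors. The root groups are $U_{[0,1]}=\{\begin{pmatrix} 1 & r \\ 0 & 1 \end{pmatrix}\mid r\in R\}$, $U_{[1,0]}=\{\begin{pmatrix} 1 & 0 \\ r & 1 \end{pmatrix}\mid r\in R\}$ (classes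 in $\mathrm{PSL}_2(R)$), and, for general $x$: $U_x=U_{[1,0]}^{g}$ with $g\in U_{[0,1]}$ the unique element mapping $[1,0]$ to $x$ if $x\nsim[0,1]$, and $U_x=U_{[0,1]}^{g}$ with $g\in U_{[1,0]}$ the unique element mapping $[0,1]$ to $x$ if $x\sim[0,1]$. This is a local Moufang set. *)

theory Defs
  imports "HOL-Algebra.Bij" "HOL-Algebra.Generated_Groups" "HOL-Algebra.Ideal"
begin

text \<open>Actions are on the right: \<open>x \<triangleleft> g\<close> is the image of \<open>x\<close> under \<open>g\<close>.\<close>

abbreviation (input) right_app :: "'a \<Rightarrow> ('a \<Rightarrow> 'b) \<Rightarrow> 'b" (infixl "\<triangleleft>" 75)
  where "x \<triangleleft> g \<equiv> g x"


section \<open>Local Moufang sets\<close>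

text \<open>
  The group \<open>Sym(X,\<sim>)\<close>. As in \<^const>\<open>BijGroup\<close>, permutations of \<open>X\<close> are extensional functions,
  but products are composed from left to right, i.e. \<open>x \<triangleleft> (g \<otimes> h) = x \<triangleleft> g \<triangleleft> h\<close>.
\<close>

definition eqv_sym :: "'a set \<Rightarrow> ('a \<times> 'a) set \<Rightarrow> ('a \<Rightarrow> 'a) monoid"
  where "eqv_sym X r =
    \<lparr>carrier = {g \<in> Bij X. \<forall>x\<in>X. \<forall>y\<in>X. (x \<triangleleft> g, y \<triangleleft> g) \<in> r \<longleftrightarrow> (x, y) \<in> r},
     mult = (\<lambda>g h. compose X h g),
     one = (\<lambda>x\<in>X. x)\<rparr>"

lemma group_eqv_sym: "group (eqv_sym X r)"
proof (rule groupI)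
  fix g assume "g \<in> carrier (eqv_sym X r)"
  then have g: "g \<in> Bij X" "\<forall>x\<in>X. \<forall>y\<in>X. (g x, g y) \<in> r \<longleftrightarrow> (x, y) \<in> r"
    by (auto simp: eqv_sym_def)
  let ?h = "\<lambda>x\<in>X. inv_into X g x"
  have h: "inv_into X g x \<in> X" "g (inv_into X g x) = x" if "x \<in> X" for x
    using g(1) that by (auto simp: Bij_def bij_betw_def inv_into_into f_inv_into_f)
  have "(?h x, ?h y) \<in> r \<longleftrightarrow> (x, y) \<in> r" if "x \<in> X" "y \<in> X" for x y
    using g(2)[rule_format, OF h(1)[OF that(1)] h(1)[OF that(2)]] h(2) that by simp
  moreover have "compose X g ?h = (\<lambda>x\<in>X. x)"
    using h(2) by (auto simp: compose_def)
  ultimately show "\<exists>h\<in>carrier (eqv_sym X r). h \<otimes>\<^bsub>eqv_sym X r\<^esub> g = \<one>\<^bsub>eqv_sym X r\<^esub>"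
    using restrict_inv_into_Bij[OF g(1)] by (intro bexI[of _ ?h]) (auto simp: eqv_sym_def)
next
  fix g h k assume "g \<in> carrier (eqv_sym X r)"
  then show "g \<otimes>\<^bsub>eqv_sym X r\<^esub> h \<otimes>\<^bsub>eqv_sym X r\<^esub> k = g \<otimes>\<^bsub>eqv_sym X r\<^esub> (h \<otimes>\<^bsub>eqv_sym X r\<^esub> k)"
    by (auto simp: eqv_sym_def compose_def Bij_def bij_betw_def fun_eq_iff)
next
  fix g h assume "g \<in> carrier (eqv_sym X r)" "h \<in> carrier (eqv_sym X r)"
  moreover from this have "\<forall>x\<in>X. g x \<in> X"
    by (auto simp: eqv_sym_def Bij_def bij_betw_def)
  ultimately show "g \<otimes>\<^bsub>eqv_sym X r\<^esub> h \<in> carrier (eqv_sym X r)"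
    by (auto simp: eqv_sym_def compose_Bij compose_eq)
qed (auto simp: eqv_sym_def Bij_def bij_betw_def inj_on_def compose_def extensional_def fun_eq_iff)

definition conj_set :: "('g, 'b) monoid_scheme \<Rightarrow> 'g set \<Rightarrow> 'g \<Rightarrow> 'g set"
  where "conj_set G K g = (\<lambda>k. inv\<^bsub>G\<^esub> g \<otimes>\<^bsub>G\<^esub> k \<otimes>\<^bsub>G\<^esub> g) ` K"

definition sharply_transitive :: "('a \<Rightarrow> 'a) set \<Rightarrow> 'a set \<Rightarrow> bool"
  where "sharply_transitive K Y \<longleftrightarrow> (\<forall>y\<in>Y. \<forall>z\<in>Y. \<exists>!k. k \<in> K \<and> y \<triangleleft> k = z)"

record 'a moufang =
  points :: "'a set"
  sim :: "('a \<times> 'a) set"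
  root_group :: "'a \<Rightarrow> ('a \<Rightarrow> 'a) set"

abbreviation symg :: "('a, 'm) moufang_scheme \<Rightarrow> ('a \<Rightarrow> 'a) monoid"
  where "symg M \<equiv> eqv_sym (points M) (sim M)"

definition induced :: "('a, 'm) moufang_scheme \<Rightarrow> ('a \<Rightarrow> 'a) \<Rightarrow> 'a set \<Rightarrow> 'a set"
  where "induced M g = (\<lambda>C \<in> points M // sim M. g ` C)"

definition class_root_group :: "('a, 'm) moufang_scheme \<Rightarrow> 'a \<Rightarrow> ('a set \<Rightarrow> 'a set) set"
  where "class_root_group M x = induced M ` root_group M x"

definition little_projective_group :: "('a, 'm) moufang_scheme \<Rightarrow> ('a \<Rightarrow> 'a) set"
  where "little_projective_group M = generate (symg M) (\<Union>x\<in>points M. root_group M x)"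

locale local_moufang_set =
  fixes M :: "('a, 'm) moufang_scheme"
  assumes equiv_sim: "equiv (points M) (sim M)"
    and more_than_two_classes:
      "infinite (points M // sim M) \<or> card (points M // sim M) > 2"
    and root_subgroup: "x \<in> points M \<Longrightarrow> subgroup (root_group M x) (symg M)"
    and LM1: "(x, y) \<in> sim M \<Longrightarrow> class_root_group M x = class_root_group M y"
    and LM2_fix: "x \<in> points M \<Longrightarrow> u \<in> root_group M x \<Longrightarrow> x \<triangleleft> u = x"
    and LM2_sharp: "x \<in> points M \<Longrightarrow>
      sharply_transitive (root_group M x) (points M - sim M `` {x})"
    and LM2'_fix: "x \<in> points M \<Longrightarrow> v \<in> class_root_group M x \<Longrightarrow>
      sim M `` {x} \<triangleleft> v = sim M `` {x}"
    and LM2'_sharp: "x \<in> points M \<Longrightarrow>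
      sharply_transitive (class_root_group M x) (points M // sim M - {sim M `` {x}})"
    and LM3: "x \<in> points M \<Longrightarrow> g \<in> little_projective_group M \<Longrightarrow>
      conj_set (symg M) (root_group M x) g = root_group M (x \<triangleleft> g)"

definition moufang_isomorphic :: "('a, 'm) moufang_scheme \<Rightarrow> ('b, 'n) moufang_scheme \<Rightarrow> bool"
  where "moufang_isomorphic M M' \<longleftrightarrow>
    (\<exists>\<phi> \<theta>. bij_betw \<phi> (points M) (points M')
      \<and> (\<forall>x\<in>points M. \<theta> x \<in> iso (symg M \<lparr>carrier := root_group M x\<rparr>)
                               (symg M' \<lparr>carrier := root_group M' (\<phi> x)\<rparr>))
      \<and> (\<forall>x\<in>points M. \<forall>y\<in>points M. (x, y) \<in> sim M \<longleftrightarrow> (\<phi> x, \<phi> y) \<in> sim M')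
      \<and> (\<forall>x\<in>points M. \<forall>y\<in>points M. \<forall>u\<in>root_group M y. \<phi> (x \<triangleleft> u) = \<phi> x \<triangleleft> \<theta> y u))"


section \<open>Base points, \<open>\<mu>\<close>-maps and the Hua subgroup\<close>

record 'a pointed_moufang = "'a moufang" +
  pt0 :: 'a
  ptinf :: 'a

locale pointed_local_moufang_set = local_moufang_set M
  for M :: "('a, 'm) pointed_moufang_scheme" +
  assumes pt0_in: "pt0 M \<in> points M"
    and ptinf_in: "ptinf M \<in> points M"
    and pt0_not_sim_ptinf: "(pt0 M, ptinf M) \<notin> sim M"

definition alpha :: "('a, 'm) pointed_moufang_scheme \<Rightarrow> 'a \<Rightarrow> 'a \<Rightarrow> 'a"
  where "alpha M x = (THE u. u \<in> root_group M (ptinf M) \<and> pt0 M \<triangleleft> u = x)"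

definition mneg :: "('a, 'm) pointed_moufang_scheme \<Rightarrow> 'a \<Rightarrow> 'a"
  where "mneg M x = pt0 M \<triangleleft> inv\<^bsub>symg M\<^esub> (alpha M x)"

definition mdouble :: "('a, 'm) pointed_moufang_scheme \<Rightarrow> 'a \<Rightarrow> 'a"
  where "mdouble M x = pt0 M \<triangleleft> (alpha M x [^]\<^bsub>symg M\<^esub> (2::nat))"

definition munits :: "('a, 'm) pointed_moufang_scheme \<Rightarrow> 'a set"
  where "munits M = {x \<in> points M. (x, pt0 M) \<notin> sim M \<and> (x, ptinf M) \<notin> sim M}"

definition mu :: "('a, 'm) pointed_moufang_scheme \<Rightarrow> 'a \<Rightarrow> 'a \<Rightarrow> 'a"
  where "mu M x = (THE g.
    g \<in> root_group M (pt0 M) <#>\<^bsub>symg M\<^esub> {alpha M x} <#>\<^bsub>symg M\<^esub> root_group M (pt0 M)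
    \<and> pt0 M \<triangleleft> g = ptinf M \<and> ptinf M \<triangleleft> g = pt0 M)"

definition hua_subgroup :: "('a, 'm) pointed_moufang_scheme \<Rightarrow> ('a \<Rightarrow> 'a) set"
  where "hua_subgroup M =
    generate (symg M) {mu M x \<otimes>\<^bsub>symg M\<^esub> mu M y | x y. x \<in> munits M \<and> y \<in> munits M}"

text \<open>
  In a local Moufang set the condition below does not depend on the choice of the \<open>\<mu>\<close>-map \<open>\<tau>\<close>,
  and \<open>\<mu>\<close>-maps exist since there are more than two classes.
\<close>

definition special :: "('a, 'm) pointed_moufang_scheme \<Rightarrow> bool"
  where "special M \<longleftrightarrow>
    (\<exists>\<tau>\<in>mu M ` munits M. \<forall>x\<in>munits M. mneg M x \<triangleleft> \<tau> = mneg M (x \<triangleleft> \<tau>))"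


section \<open>The ring of a local Moufang set\<close>

definition mring_carrier :: "('a, 'm) pointed_moufang_scheme \<Rightarrow> 'a set"
  where "mring_carrier M = points M - sim M `` {ptinf M}"

definition madd :: "('a, 'm) pointed_moufang_scheme \<Rightarrow> 'a \<Rightarrow> 'a \<Rightarrow> 'a"
  where "madd M x y = pt0 M \<triangleleft> (alpha M x \<otimes>\<^bsub>symg M\<^esub> alpha M y)"

definition msub :: "('a, 'm) pointed_moufang_scheme \<Rightarrow> 'a \<Rightarrow> 'a \<Rightarrow> 'a"
  where "msub M x y = madd M x (mneg M y)"

definition mhalf :: "('a, 'm) pointed_moufang_scheme \<Rightarrow> 'a \<Rightarrow> 'a"
  where "mhalf M z = (THE w. w \<in> mring_carrier M \<and> madd M w w = z)"

definition hua :: "('a, 'm) pointed_moufang_scheme \<Rightarrow> 'a \<Rightarrow> 'a \<Rightarrow> 'a \<Rightarrow> 'a"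
  where "hua M e x = mu M e \<otimes>\<^bsub>symg M\<^esub> mu M x"

text \<open>\<open>rmap M e y\<close> is the map \<open>R\<^sub>y\<close>; with the notation of rings its three cases read
  \<open>x h\<^bsub>e+y\<^esub> - x h\<^bsub>y\<^esub> - x\<close>, \<open>-(x h\<^bsub>-e+y\<^esub>) + x + x h\<^bsub>y\<^esub>\<close> and
  \<open>x h\<^bsub>2e+y\<^esub> - x h\<^bsub>e+y\<^esub> - x h\<^bsub>-2e\<^esub> + x\<close>.\<close>

definition rmap :: "('a, 'm) pointed_moufang_scheme \<Rightarrow> 'a \<Rightarrow> 'a \<Rightarrow> 'a \<Rightarrow> 'a"
  where "rmap M e y x =
    (if y \<in> munits M \<and> madd M y e \<in> munits M then
       msub M (msub M (x \<triangleleft> hua M e (madd M e y)) (x \<triangleleft> hua M e y)) x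
     else if y \<in> munits M then
       madd M (madd M (mneg M (x \<triangleleft> hua M e (madd M (mneg M e) y))) x) (x \<triangleleft> hua M e y)
     else
       madd M
         (msub M
           (msub M (x \<triangleleft> hua M e (madd M (madd M e e) y)) (x \<triangleleft> hua M e (madd M e y)))
           (x \<triangleleft> hua M e (mneg M (madd M e e))))
         x)"

definition mring :: "('a, 'm) pointed_moufang_scheme \<Rightarrow> 'a \<Rightarrow> 'a ring"
  where "mring M e =
    \<lparr>carrier = mring_carrier M,
     mult = (\<lambda>x y. mhalf M (x \<triangleleft> rmap M e y)),
     one = e,
     zero = pt0 M,
     add = madd M\<rparr>"


section \<open>The local Moufang set of a local ring\<close>

text \<open>For a local ring, \<open>max_ideal R\<close> is its unique maximal ideal.\<close>

definition max_ideal :: "('r, 'm) ring_scheme \<Rightarrow> 'r set"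
  where "max_ideal R = (THE I. maximalideal I R)"

definition proj_pt :: "('r, 'm) ring_scheme \<Rightarrow> 'r \<Rightarrow> 'r \<Rightarrow> ('r \<times> 'r) set"
  where "proj_pt R a b = {(a \<otimes>\<^bsub>R\<^esub> u, b \<otimes>\<^bsub>R\<^esub> u) | u. u \<in> Units R}"

definition proj_line :: "('r, 'm) ring_scheme \<Rightarrow> ('r \<times> 'r) set set"
  where "proj_line R = {proj_pt R a b | a b. a \<in> carrier R \<and> b \<in> carrier R \<and>
    PIdl\<^bsub>R\<^esub> a <+>\<^bsub>R\<^esub> PIdl\<^bsub>R\<^esub> b = carrier R}"

definition proj_sim :: "('r, 'm) ring_scheme \<Rightarrow> (('r \<times> 'r) set \<times> ('r \<times> 'r) set) set"
  where "proj_sim R =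
    {(proj_pt R \<one>\<^bsub>R\<^esub> r, proj_pt R \<one>\<^bsub>R\<^esub> s) | r s.
       r \<in> carrier R \<and> s \<in> carrier R \<and> r \<ominus>\<^bsub>R\<^esub> s \<in> max_ideal R}
    \<union> {(proj_pt R m \<one>\<^bsub>R\<^esub>, proj_pt R n \<one>\<^bsub>R\<^esub>) | m n. m \<in> max_ideal R \<and> n \<in> max_ideal R}"

text \<open>
  The permutation of the projective line induced by right multiplication of row vectors with the
  matrix with rows \<open>(a, b)\<close> and \<open>(c, d)\<close>. As \<open>PSL\<^sub>2(R)\<close> acts faithfully on the projective line,
  its elements are identified with the permutations they induce; in this way the root groups below
  are subgroups of the symmetric group, as required in a local Moufang set.
\<close>

definition mat2_perm ::
    "('r, 'm) ring_scheme \<Rightarrow> 'r \<Rightarrow> 'r \<Rightarrow> 'r \<Rightarrow> 'r \<Rightarrow> ('r \<times> 'r) set \<Rightarrow> ('r \<times> 'r) set"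
  where "mat2_perm R a b c d = (\<lambda>P \<in> proj_line R.
    (\<lambda>(v, w). (v \<otimes>\<^bsub>R\<^esub> a \<oplus>\<^bsub>R\<^esub> w \<otimes>\<^bsub>R\<^esub> c, v \<otimes>\<^bsub>R\<^esub> b \<oplus>\<^bsub>R\<^esub> w \<otimes>\<^bsub>R\<^esub> d)) ` P)"

definition proj_upper :: "('r, 'm) ring_scheme \<Rightarrow> (('r \<times> 'r) set \<Rightarrow> ('r \<times> 'r) set) set"
  where "proj_upper R = {mat2_perm R \<one>\<^bsub>R\<^esub> r \<zero>\<^bsub>R\<^esub> \<one>\<^bsub>R\<^esub> | r. r \<in> carrier R}"

definition proj_lower :: "('r, 'm) ring_scheme \<Rightarrow> (('r \<times> 'r) set \<Rightarrow> ('r \<times> 'r) set) set"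
  where "proj_lower R = {mat2_perm R \<one>\<^bsub>R\<^esub> \<zero>\<^bsub>R\<^esub> r \<one>\<^bsub>R\<^esub> | r. r \<in> carrier R}"

definition proj_root_group ::
    "('r, 'm) ring_scheme \<Rightarrow> ('r \<times> 'r) set \<Rightarrow> (('r \<times> 'r) set \<Rightarrow> ('r \<times> 'r) set) set"
  where "proj_root_group R P =
    (let G = eqv_sym (proj_line R) (proj_sim R);
         p0 = proj_pt R \<one>\<^bsub>R\<^esub> \<zero>\<^bsub>R\<^esub>;
         pinf = proj_pt R \<zero>\<^bsub>R\<^esub> \<one>\<^bsub>R\<^esub>
     in if (P, pinf) \<notin> proj_sim R
        then conj_set G (proj_lower R) (THE g. g \<in> proj_upper R \<and> p0 \<triangleleft> g = P)
        else conj_set G (proj_upper R) (THE g. g \<in> proj_lower R \<and> pinf \<triangleleft> g = P))"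

definition proj_moufang :: "('r, 'm) ring_scheme \<Rightarrow> ('r \<times> 'r) set moufang"
  where "proj_moufang R =
    \<lparr>points = proj_line R, sim = proj_sim R, root_group = proj_root_group R\<rparr>"

end

theory Submission
  imports Defs
begin

text \<open>
  Let \<open>\<tau> = \<mu>\<^sub>e\<close>. Being special makes \<open>\<mu>\<^sub>x = \<alpha>\<^sub>x \<gamma>\<^sub>-\<^sub>x \<alpha>\<^sub>x\<close>, where \<open>\<gamma>\<^sub>x \<in> U\<^sub>0\<close> maps \<open>\<infinity>\<close> to \<open>x\<close>,
  so \<open>z\<mu>\<^sub>x = ((z + x)\<tau>\<^sup>-\<^sup>1 - x\<tau>\<^sup>-\<^sup>1)\<tau> + x\<close> whenever \<open>z\<close>, \<open>x\<close> and \<open>z + x\<close> are units. As \<open>U\<^sub>\<infinity>\<close> is abelian,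
  this formula commutes with negation; hence \<open>\<mu>\<close>-maps are involutions, and \<open>z = x\<close> gives unique
  2-divisibility. It also gives \<open>-f\<mu>\<^sub>f\<^sub>+\<^sub>y + f\<mu>\<^sub>y = f + 2y\<close>, whence \<open>e R\<^sub>y = 2y\<close> in all three cases
  of the definition of \<open>R\<^sub>y\<close>.

  The Hua maps are commuting additive maps, so the \<open>R\<^sub>y\<close> are additive and commute with each other.
  Applying \<open>R\<^sub>x R\<^sub>y = R\<^sub>y R\<^sub>x\<close> to \<open>e\<close> gives \<open>xy = yx\<close>, and the remaining ring axioms follow. The same
  identity evaluates \<open>(x\<tau>)R\<^sub>x\<close> to \<open>-2e\<close>, i.e. \<open>x\<tau> = -x\<inverse>\<close>; the class of \<open>0\<close> is the maximal ideal.

  The isomorphism sends \<open>r \<in> R\<close> to \<open>[1, r]\<close> and \<open>m\<tau>\<close>, for \<open>m \<sim> 0\<close>, to \<open>[-m, 1]\<close>. It turns \<open>\<tau>\<close> into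
  the matrix with rows \<open>(0, 1)\<close> and \<open>(-1, 0)\<close>, and \<open>\<alpha>\<^sub>y\<close> into the one with rows \<open>(1, y)\<close> and \<open>(0, 1)\<close>;
  only the latter, at points equivalent to \<open>\<infinity>\<close>, needs the last hypothesis.
\<close>

section \<open>Root groups and \<open>\<mu>\<close>-maps\<close>

lemma eqv_sym_carrierD:
  assumes "g \<in> carrier (eqv_sym X r)"
  shows "g \<in> extensional X" "bij_betw g X X"
    "x \<in> X \<Longrightarrow> g x \<in> X"
    "x \<in> X \<Longrightarrow> y \<in> X \<Longrightarrow> g x = g y \<longleftrightarrow> x = y"
    "x \<in> X \<Longrightarrow> y \<in> X \<Longrightarrow> (g x, g y) \<in> r \<longleftrightarrow> (x, y) \<in> r"
  using assms by (auto simp: eqv_sym_def Bij_def bij_betw_def inj_on_def)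

lemma eqv_sym_surj:
  assumes "g \<in> carrier (eqv_sym X r)" "y \<in> X"
  obtains x where "x \<in> X" "g x = y"
  using eqv_sym_carrierD(2)[OF assms(1)] assms(2) that
  unfolding bij_betw_def by (metis imageE)

lemma eqv_sym_mult [simp]: "x \<in> X \<Longrightarrow> (g \<otimes>\<^bsub>eqv_sym X r\<^esub> h) x = h (g x)"
  by (simp add: eqv_sym_def compose_eq)

lemma eqv_sym_one [simp]: "x \<in> X \<Longrightarrow> \<one>\<^bsub>eqv_sym X r\<^esub> x = x"
  by (simp add: eqv_sym_def)

lemma eqv_sym_eqI:
  assumes "g \<in> carrier (eqv_sym X r)" "h \<in> carrier (eqv_sym X r)" "\<And>x. x \<in> X \<Longrightarrow> g x = h x"
  shows "g = h"
  using assms eqv_sym_carrierD(1) extensionalityI by metis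

lemma eqv_sym_inv:
  assumes "g \<in> carrier (eqv_sym X r)" "x \<in> X"
  shows "(inv\<^bsub>eqv_sym X r\<^esub> g) (g x) = x" "g ((inv\<^bsub>eqv_sym X r\<^esub> g) x) = x"
proof -
  interpret group "eqv_sym X r" by (rule group_eqv_sym)
  show "(inv\<^bsub>eqv_sym X r\<^esub> g) (g x) = x"
    using r_inv[OF assms(1)] assms(2) by (metis eqv_sym_mult eqv_sym_one)
  show "g ((inv\<^bsub>eqv_sym X r\<^esub> g) x) = x"
    using l_inv[OF assms(1)] assms(2) by (metis eqv_sym_mult eqv_sym_one)
qed

section \<open>Transport of permutations along a bijection respecting the equivalences\<close>

locale eqv_bij =
  fixes \<phi> :: "'a \<Rightarrow> 'b" and X :: "'a set" and r :: "('a \<times> 'a) set"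
    and Y :: "'b set" and s :: "('b \<times> 'b) set"
  assumes bij: "bij_betw \<phi> X Y"
    and sim_iff: "x \<in> X \<Longrightarrow> y \<in> X \<Longrightarrow> (x, y) \<in> r \<longleftrightarrow> (\<phi> x, \<phi> y) \<in> s"
begin

text \<open>Conjugation by \<open>\<phi>\<close>, cut down to \<open>Y\<close> because elements of
  \<open>eqv_sym Y s\<close> are extensional. One such map will serve as every isomorphism of root
  groups.\<close>

definition transport :: "('a \<Rightarrow> 'a) \<Rightarrow> 'b \<Rightarrow> 'b"
  where "transport u = (\<lambda>q\<in>Y. \<phi> (u (inv_into X \<phi> q)))"

lemma \<phi>_in: "x \<in> X \<Longrightarrow> \<phi> x \<in> Y"
  using bij by (auto simp: bij_betw_def)

lemma \<phi>_surj: "q \<in> Y \<Longrightarrow> \<exists>x\<in>X. q = \<phi> x"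
  using bij by (auto simp: bij_betw_def)

lemma \<phi>_eq_iff: "x \<in> X \<Longrightarrow> y \<in> X \<Longrightarrow> \<phi> x = \<phi> y \<longleftrightarrow> x = y"
  using bij by (auto simp: bij_betw_def inj_on_def)

lemma transport_app: "x \<in> X \<Longrightarrow> transport u (\<phi> x) = \<phi> (u x)"
  using bij by (simp add: transport_def \<phi>_in bij_betw_inv_into_left)

lemma transport_eqI:
  assumes "f \<in> extensional Y" "\<And>x. x \<in> X \<Longrightarrow> f (\<phi> x) = \<phi> (u x)"
  shows "transport u = f"
proof (rule extensionalityI[OF _ assms(1)])
  show "transport u \<in> extensional Y" by (simp add: transport_def)
  show "transport u q = f q" if "q \<in> Y" for q
    using \<phi>_surj[OF that] assms(2) by (auto simp: transport_app)
qed

lemma transport_carrier: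
  assumes u: "u \<in> carrier (eqv_sym X r)"
  shows "transport u \<in> carrier (eqv_sym Y s)"
proof -
  note u = eqv_sym_carrierD[OF u] eqv_sym_surj[OF u]
  have "transport u ` Y = Y"
  proof
    show "transport u ` Y \<subseteq> Y" using \<phi>_surj u(3) \<phi>_in by (force simp: transport_app)
    show "Y \<subseteq> transport u ` Y"
    proof
      fix q assume "q \<in> Y"
      then obtain x where "x \<in> X" "q = \<phi> x" using \<phi>_surj by blast
      moreover then obtain y where "y \<in> X" "u y = x" using u(6) by blast
      ultimately show "q \<in> transport u ` Y" using transport_app \<phi>_in by (metis image_eqI)
    qed
  qed
  moreover have "inj_on (transport u) Y"
  proof (rule inj_onI)
    fix p q assume "p \<in> Y" "q \<in> Y" and eq: "transport u p = transport u q"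
    then obtain x y where "x \<in> X" "y \<in> X" "p = \<phi> x" "q = \<phi> y" using \<phi>_surj by blast
    then show "p = q" using eq u(3,4) by (simp add: transport_app \<phi>_eq_iff)
  qed
  moreover have "(transport u p, transport u q) \<in> s \<longleftrightarrow> (p, q) \<in> s" if pq: "p \<in> Y" "q \<in> Y" for p q
  proof -
    obtain x y where "x \<in> X" "y \<in> X" "p = \<phi> x" "q = \<phi> y" using \<phi>_surj pq by blast
    then show ?thesis using u(3,5) by (simp add: transport_app sim_iff[symmetric])
  qed
  ultimately show ?thesis
    by (simp add: eqv_sym_def Bij_def bij_betw_def) (simp add: transport_def)
qed

lemma transport_mult:
  assumes "u \<in> carrier (eqv_sym X r)"
  shows "transport (u \<otimes>\<^bsub>eqv_sym X r\<^esub> v) = transport u \<otimes>\<^bsub>eqv_sym Y s\<^esub> transport v"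
proof (rule transport_eqI)
  show "transport u \<otimes>\<^bsub>eqv_sym Y s\<^esub> transport v \<in> extensional Y"
    by (simp add: eqv_sym_def compose_def)
qed (use eqv_sym_carrierD(3)[OF assms] in \<open>simp add: \<phi>_in transport_app\<close>)

lemma transport_inj:
  assumes "u \<in> carrier (eqv_sym X r)" "v \<in> carrier (eqv_sym X r)" "transport u = transport v"
  shows "u = v"
  using assms(3) eqv_sym_carrierD(3)[OF assms(1)] eqv_sym_carrierD(3)[OF assms(2)]
  by (intro eqv_sym_eqI[OF assms(1,2)]) (metis transport_app \<phi>_eq_iff)

lemma transport_hom: "transport \<in> hom (eqv_sym X r) (eqv_sym Y s)"
  by (rule homI) (simp_all add: transport_carrier transport_mult)

lemma transport_inv:
  assumes "u \<in> carrier (eqv_sym X r)"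
  shows "transport (inv\<^bsub>eqv_sym X r\<^esub> u) = inv\<^bsub>eqv_sym Y s\<^esub> transport u"
proof -
  interpret group_hom "eqv_sym X r" "eqv_sym Y s" transport
    by (intro group_hom.intro group_eqv_sym group_hom_axioms.intro transport_hom)
  show ?thesis using assms by simp
qed

text \<open>On both sides of the isomorphism all root groups are conjugates of two of them, so
  compatibility with conjugation reduces their comparison to those two.\<close>

lemma transport_conj_set:
  assumes "S \<subseteq> carrier (eqv_sym X r)" "g \<in> carrier (eqv_sym X r)"
  shows "transport ` conj_set (eqv_sym X r) S g = conj_set (eqv_sym Y s) (transport ` S) (transport g)"
proof -
  interpret group "eqv_sym X r" by (rule group_eqv_sym)
  show ?thesis
    unfolding conj_set_def image_image using assms
    by (intro image_cong refl) (simp add: transport_mult transport_inv subset_iff)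
qed

end

section \<open>Root groups inside the little projective group\<close>

context local_moufang_set
begin

sublocale sym: group "symg M" by (rule group_eqv_sym)

abbreviation eqv (infix "\<sim>" 50) where "x \<sim> y \<equiv> (x, y) \<in> sim M"

lemma eqv_in: "x \<sim> y \<Longrightarrow> x \<in> points M" "x \<sim> y \<Longrightarrow> y \<in> points M"
  using equiv_sim by (auto simp: equiv_def refl_on_def)

lemma eqv_refl [simp]: "x \<in> points M \<Longrightarrow> x \<sim> x"
  using equiv_sim by (auto simp: equiv_def refl_on_def)

lemma eqv_commute: "x \<sim> y \<Longrightarrow> y \<sim> x"
  using equiv_sim by (auto simp: equiv_def sym_def)

lemma eqv_trans: "x \<sim> y \<Longrightarrow> y \<sim> z \<Longrightarrow> x \<sim> z"
  using equiv_sim unfolding equiv_def trans_def by blast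

lemma roots_subset: "(\<Union>x\<in>points M. root_group M x) \<subseteq> carrier (symg M)"
  using root_subgroup subgroup.subset by blast

lemma lpg_carrier: "g \<in> little_projective_group M \<Longrightarrow> g \<in> carrier (symg M)"
  unfolding little_projective_group_def
  by (rule sym.generate_in_carrier[OF roots_subset])

lemma root_lpg: "x \<in> points M \<Longrightarrow> u \<in> root_group M x \<Longrightarrow> u \<in> little_projective_group M"
  unfolding little_projective_group_def by (rule generate.incl) blast

lemma lpg_mult: "g \<in> little_projective_group M \<Longrightarrow> h \<in> little_projective_group M \<Longrightarrow>
    g \<otimes>\<^bsub>symg M\<^esub> h \<in> little_projective_group M"
  unfolding little_projective_group_def by (rule generate.eng)

lemma lpg_inv: "g \<in> little_projective_group M \<Longrightarrow> inv\<^bsub>symg M\<^esub> g \<in> little_projective_group M"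
  unfolding little_projective_group_def
  by (rule sym.generate_m_inv_closed[OF roots_subset])

lemmas lpgD = eqv_sym_carrierD(3-5)[OF lpg_carrier]
lemmas lpg_app = lpgD(1)
lemmas root_carrier = lpg_carrier[OF root_lpg]

lemma root_mult: "x \<in> points M \<Longrightarrow> u \<in> root_group M x \<Longrightarrow> v \<in> root_group M x \<Longrightarrow>
    u \<otimes>\<^bsub>symg M\<^esub> v \<in> root_group M x"
  by (meson root_subgroup subgroup.m_closed)

lemma root_inv: "x \<in> points M \<Longrightarrow> u \<in> root_group M x \<Longrightarrow> inv\<^bsub>symg M\<^esub> u \<in> root_group M x"
  by (meson root_subgroup subgroup.m_inv_closed)

lemma root_ex1:
  assumes "x \<in> points M" "p \<in> points M" "q \<in> points M" "\<not> p \<sim> x" "\<not> q \<sim> x"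
  shows "\<exists>!u. u \<in> root_group M x \<and> u p = q"
  using LM2_sharp[OF assms(1)] assms eqv_commute unfolding sharply_transitive_def by blast

text \<open>Sharp transitivity needs the common image to lie outside the class of \<open>x\<close>;
  it does, because \<open>u\<close> fixes \<open>x\<close> and preserves the equivalence.\<close>

lemma root_eqI:
  assumes "x \<in> points M" "u \<in> root_group M x" "v \<in> root_group M x"
    "p \<in> points M" "\<not> p \<sim> x" "u p = v p"
  shows "u = v"
proof -
  have "u x = x" "u \<in> carrier (symg M)"
    using assms LM2_fix root_carrier by auto
  then have "u p \<in> points M" "\<not> u p \<sim> x"
    using assms eqv_sym_carrierD(3,5) by metis+
  then show ?thesis using root_ex1[OF assms(1,4) _ assms(5)] assms by metis
qed

text \<open>(LM3) for single elements, with \<open>v\<close> the conjugate of \<open>u\<close> by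
  \<open>g\<close>: the equation is u g = g v read at a point, which keeps inverses out of later
  calculations.\<close>

lemma conj_root:
  assumes "x \<in> points M" "g \<in> little_projective_group M" "u \<in> root_group M x"
  obtains v where "v \<in> root_group M (g x)" "\<And>p. p \<in> points M \<Longrightarrow> g (u p) = v (g p)"
proof
  let ?v = "inv\<^bsub>symg M\<^esub> g \<otimes>\<^bsub>symg M\<^esub> u \<otimes>\<^bsub>symg M\<^esub> g"
  show "?v \<in> root_group M (g x)"
    using LM3[OF assms(1,2)] assms(3) by (auto simp: conj_set_def)
  fix p assume "p \<in> points M"
  then show "g (u p) = ?v (g p)"
    using lpg_carrier[OF assms(2)] lpg_app[OF assms(2)]
    by (simp add: eqv_sym_inv)
qed

end

section \<open>Base points and addition\<close>

context pointed_local_moufang_set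
begin

abbreviation "Z \<equiv> pt0 M"
abbreviation "W \<equiv> ptinf M"
abbreviation "R \<equiv> mring_carrier M"
abbreviation "U \<equiv> munits M"

lemma not_eqv [simp]: "\<not> Z \<sim> W" "\<not> W \<sim> Z"
  using pt0_not_sim_ptinf eqv_commute by blast+

lemma carrier_iff: "x \<in> R \<longleftrightarrow> x \<in> points M \<and> \<not> x \<sim> W"
  unfolding mring_carrier_def using eqv_commute by blast

lemma unit_iff: "x \<in> U \<longleftrightarrow> x \<in> R \<and> \<not> x \<sim> Z"
  unfolding munits_def carrier_iff by blast

lemma carrier_pt: "x \<in> R \<Longrightarrow> x \<in> points M" by (simp add: carrier_iff)
lemma unit_carrier: "x \<in> U \<Longrightarrow> x \<in> R" by (simp add: unit_iff)
lemma unit_pt: "x \<in> U \<Longrightarrow> x \<in> points M" by (simp add: munits_def)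

lemma Z_carrier [simp]: "Z \<in> R" by (simp add: carrier_iff pt0_in)

lemma nonunit_carrier: "x \<sim> Z \<Longrightarrow> x \<in> R"
  using eqv_in eqv_commute eqv_trans not_eqv(1) unfolding carrier_iff by blast

lemma alpha: "x \<in> R \<Longrightarrow> alpha M x \<in> root_group M W" "x \<in> R \<Longrightarrow> alpha M x Z = x"
proof -
  assume x: "x \<in> R"
  from theI'[OF root_ex1, OF ptinf_in pt0_in] x
  show "alpha M x \<in> root_group M W" "alpha M x Z = x"
    unfolding alpha_def carrier_iff by auto
qed

lemma alpha_eqI: "x \<in> R \<Longrightarrow> u \<in> root_group M W \<Longrightarrow> u Z = x \<Longrightarrow> alpha M x = u"
  using root_eqI[OF ptinf_in _ _ pt0_in] alpha by simp

lemma alpha_lpg: "x \<in> R \<Longrightarrow> alpha M x \<in> little_projective_group M"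
  using root_lpg[OF ptinf_in] alpha by blast

lemma alpha_W: "x \<in> R \<Longrightarrow> alpha M x W = W"
  using LM2_fix[OF ptinf_in] alpha by blast

lemma alpha_carrier: "x \<in> R \<Longrightarrow> y \<in> R \<Longrightarrow> alpha M x y \<in> R"
  using alpha_lpg[THEN lpgD(3), of x y W] alpha_lpg lpg_app alpha_W ptinf_in
  by (auto simp: carrier_iff)

lemma madd: "x \<in> R \<Longrightarrow> y \<in> R \<Longrightarrow> madd M x y = alpha M y x"
  using pt0_in by (simp add: madd_def alpha)

lemma madd_closed [simp]: "x \<in> R \<Longrightarrow> y \<in> R \<Longrightarrow> madd M x y \<in> R"
  by (simp add: madd alpha_carrier)

text \<open>Both sides come from elements of U_infinity taking 0 to the same point, and such an
  element is unique.\<close>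

lemma alpha_madd:
  assumes "x \<in> R" "y \<in> R" "p \<in> points M"
  shows "alpha M (madd M x y) p = alpha M y (alpha M x p)"
proof -
  have "alpha M (madd M x y) = alpha M x \<otimes>\<^bsub>symg M\<^esub> alpha M y"
    using assms by (intro alpha_eqI root_mult ptinf_in) (auto simp: alpha madd_def[symmetric])
  then show ?thesis using assms(3) by simp
qed

lemma madd_Z [simp]: "x \<in> R \<Longrightarrow> madd M Z x = x"
  by (simp add: madd alpha)

lemma alpha_Z: "p \<in> points M \<Longrightarrow> alpha M Z p = p"
proof -
  have "alpha M Z = \<one>\<^bsub>symg M\<^esub>"
    using pt0_in by (intro alpha_eqI) (simp_all add: subgroup.one_closed root_subgroup ptinf_in)
  then show "p \<in> points M \<Longrightarrow> ?thesis" by simp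
qed

lemma madd_assoc: "x \<in> R \<Longrightarrow> y \<in> R \<Longrightarrow> z \<in> R \<Longrightarrow>
    madd M (madd M x y) z = madd M x (madd M y z)"
  by (metis alpha_madd carrier_pt madd madd_closed)

lemma mneg_closed [simp]:
  assumes "x \<in> R" shows "mneg M x \<in> R"
  unfolding mneg_def carrier_iff
proof
  let ?u = "inv\<^bsub>symg M\<^esub> alpha M x"
  have u: "?u \<in> root_group M W" using alpha(1)[OF assms] root_inv[OF ptinf_in] by blast
  then show "?u Z \<in> points M" using root_lpg[OF ptinf_in] lpg_app pt0_in by blast
  show "\<not> ?u Z \<sim> W"
    using lpgD(3)[OF root_lpg[OF ptinf_in u] pt0_in ptinf_in] LM2_fix[OF ptinf_in u] by simp
qed

lemma mneg_madd [simp]: "x \<in> R \<Longrightarrow> madd M (mneg M x) x = Z"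
  using pt0_in eqv_sym_inv(2)[OF lpg_carrier, OF alpha_lpg]
  by (simp add: madd) (simp add: mneg_def)

lemma mdouble: "x \<in> R \<Longrightarrow> mdouble M x = madd M x x"
  using pt0_in sym.nat_pow_0 lpg_carrier[OF alpha_lpg]
  by (simp add: mdouble_def numeral_2_eq_2 madd_def)

section \<open>The opposite root group U_0 and the explicit form of the mu-maps\<close>

definition gamma :: "'a \<Rightarrow> 'a \<Rightarrow> 'a"
  where "gamma x = (THE u. u \<in> root_group M Z \<and> u W = x)"

lemma gamma:
  assumes "x \<in> points M" "\<not> x \<sim> Z"
  shows "gamma x \<in> root_group M Z" "gamma x W = x"
  using theI'[OF root_ex1[OF pt0_in ptinf_in assms(1) not_eqv(2) assms(2)]]
  unfolding gamma_def by auto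

lemma gamma_eqI:
  assumes "x \<in> points M" "\<not> x \<sim> Z" "u \<in> root_group M Z" "u W = x"
  shows "gamma x = u"
  using root_eqI[OF pt0_in _ _ ptinf_in] gamma[OF assms(1,2)] assms by simp

lemma gamma_lpg: "x \<in> points M \<Longrightarrow> \<not> x \<sim> Z \<Longrightarrow> gamma x \<in> little_projective_group M"
  using root_lpg[OF pt0_in] gamma by blast

lemma gamma_Z: "x \<in> points M \<Longrightarrow> \<not> x \<sim> Z \<Longrightarrow> gamma x Z = Z"
  using LM2_fix[OF pt0_in] gamma by blast

lemma unitD:
  assumes "x \<in> U" shows "x \<in> points M" "\<not> x \<sim> Z" "\<not> x \<sim> W" "x \<in> R"
  using assms unfolding unit_iff carrier_iff by auto

lemma eqv_translate:
  assumes "x \<in> R" "y \<in> R" "z \<in> R"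
  shows "madd M x z \<sim> madd M y z \<longleftrightarrow> x \<sim> y"
  using assms by (simp add: madd lpgD(3)[OF alpha_lpg] carrier_pt)

lemma mneg_unit [simp]: "x \<in> U \<Longrightarrow> mneg M x \<in> U"
  using eqv_translate[of "mneg M x" Z x] eqv_commute by (auto simp: unit_iff)

text \<open>Existence and uniqueness of mu_x at once. If u alpha_x v with u, v in U_0 interchanges
  the base points, then u must send infinity to -x and v must send x to infinity; sharp transitivity
  determines both factors.\<close>

lemma mu_aux:
  assumes x: "x \<in> U"
  defines "g \<equiv> gamma (mneg M x) \<otimes>\<^bsub>symg M\<^esub> alpha M x \<otimes>\<^bsub>symg M\<^esub> inv\<^bsub>symg M\<^esub> gamma x"
  shows "mu M x = g" "g Z = W" "g W = Z" "g \<in> little_projective_group M"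
proof -
  note xs = unitD[OF x] and ns = unitD[OF mneg_unit[OF x]]
  have ax: "alpha M x \<in> carrier (symg M)" and gx: "gamma x \<in> carrier (symg M)"
    and gn: "gamma (mneg M x) \<in> carrier (symg M)"
    using lpg_carrier alpha_lpg gamma_lpg xs ns by auto
  have a0: "alpha M x (mneg M x) = Z"
    using mneg_madd[OF xs(4)] madd[OF ns(4) xs(4)] by simp
  have inv1: "(inv\<^bsub>symg M\<^esub> gamma x) x = W"
    using eqv_sym_inv(1)[OF gx ptinf_in] gamma(2)[OF xs(1,2)] by simp
  have inv2: "(inv\<^bsub>symg M\<^esub> gamma x) Z = Z"
    using eqv_sym_inv(1)[OF gx pt0_in] gamma_Z[OF xs(1,2)] by simp
  show Z: "g Z = W" and W: "g W = Z"
    using pt0_in ptinf_in xs ns ax gn eqv_sym_carrierD(3)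
    by (auto simp: g_def gamma_Z alpha inv1 inv2 a0 gamma)
  show "g \<in> little_projective_group M"
    unfolding g_def using xs ns by (intro lpg_mult lpg_inv alpha_lpg gamma_lpg)
  show "mu M x = g"
    unfolding mu_def
  proof (rule the_equality, intro conjI Z W)
    show "g \<in> root_group M Z <#>\<^bsub>symg M\<^esub> {alpha M x} <#>\<^bsub>symg M\<^esub> root_group M Z"
      unfolding g_def set_mult_def
      using gamma(1)[OF xs(1,2)] gamma(1)[OF ns(1,2)] root_inv[OF pt0_in] by blast
    fix k assume k: "k \<in> root_group M Z <#>\<^bsub>symg M\<^esub> {alpha M x} <#>\<^bsub>symg M\<^esub> root_group M Z
      \<and> k Z = W \<and> k W = Z"
    then obtain u v where uv: "u \<in> root_group M Z" "v \<in> root_group M Z"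
      and k_eq: "k = u \<otimes>\<^bsub>symg M\<^esub> alpha M x \<otimes>\<^bsub>symg M\<^esub> v"
      unfolding set_mult_def by auto
    have uc: "u \<in> carrier (symg M)" and vc: "v \<in> carrier (symg M)"
      using uv root_carrier pt0_in by blast+
    have uvZ: "u Z = Z" "v Z = Z" using uv LM2_fix pt0_in by auto
    have vx: "v x = W" using k pt0_in uvZ xs alpha eqv_sym_carrierD(3)[OF uc]
      by (simp add: k_eq)
    have "v (alpha M x (u W)) = Z"
      using k ptinf_in uc by (simp add: k_eq)
    then have "alpha M x (u W) = Z"
      using uvZ eqv_sym_carrierD(3,4)[OF vc] eqv_sym_carrierD(3)[OF ax]
        eqv_sym_carrierD(3)[OF uc ptinf_in] pt0_in by metis
    then have "u W = mneg M x"
      using a0 eqv_sym_carrierD(4)[OF ax] eqv_sym_carrierD(3)[OF uc ptinf_in] ns(1) by metis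
    then have "u = gamma (mneg M x)"
      using gamma_eqI[OF ns(1,2) uv(1)] by simp
    moreover have "v = inv\<^bsub>symg M\<^esub> gamma x"
      using vx inv1 gamma(1)[OF xs(1,2)] root_inv[OF pt0_in] uv(2) xs
      by (intro root_eqI[OF pt0_in, of _ _ x]) auto
    ultimately show "k = g" by (simp add: k_eq g_def)
  qed
qed

lemma mu_Z: "x \<in> U \<Longrightarrow> mu M x Z = W" and mu_W: "x \<in> U \<Longrightarrow> mu M x W = Z"
  and mu_lpg: "x \<in> U \<Longrightarrow> mu M x \<in> little_projective_group M"
  using mu_aux by auto

lemma mu_unit: "x \<in> U \<Longrightarrow> y \<in> U \<Longrightarrow> mu M x y \<in> U"
  using lpgD(3)[OF mu_lpg] lpg_app[OF mu_lpg] mu_Z mu_W unitD pt0_in ptinf_in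
  unfolding munits_def mem_Collect_eq by metis

lemma mu_not_eqv_Z: "x \<in> U \<Longrightarrow> y \<in> R \<Longrightarrow> mu M x y \<in> points M \<and> \<not> mu M x y \<sim> Z"
  using lpgD(3)[OF mu_lpg] lpg_app[OF mu_lpg] mu_W ptinf_in unfolding carrier_iff by metis

text \<open>Preimages replace values of the inverse of \<open>mu M x\<close> until mu-maps are known
  to be involutions.\<close>

lemma mu_surj_unit:
  assumes "x \<in> U" "y \<in> U"
  obtains z where "z \<in> U" "mu M x z = y"
proof -
  obtain z where z: "z \<in> points M" "mu M x z = y"
    using eqv_sym_surj[OF lpg_carrier[OF mu_lpg[OF assms(1)]]] unit_pt[OF assms(2)] by blast
  have "z \<in> U"
    using unitD[OF assms(2)] z lpgD(3)[OF mu_lpg[OF assms(1)] z(1)] mu_Z[OF assms(1)]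
      mu_W[OF assms(1)] pt0_in ptinf_in unfolding munits_def by (metis (mono_tags, lifting) mem_Collect_eq)
  with z that show thesis by blast
qed

lemma fix_carrier:
  assumes "g \<in> little_projective_group M" "g W = W" "x \<in> R"
  shows "g x \<in> R"
  using assms lpgD(3)[OF assms(1)] lpg_app ptinf_in unfolding carrier_iff by metis

text \<open>Conjugation by \<open>g\<close> sends alpha_y to the element of U_infinity taking 0 to
  the image of y under \<open>g\<close>. The Hua maps are the main instance.\<close>

lemma fix_madd:
  assumes g: "g \<in> little_projective_group M" "g Z = Z" "g W = W" and "x \<in> R" "y \<in> R"
  shows "g (madd M x y) = madd M (g x) (g y)"
proof -
  obtain v where v: "v \<in> root_group M W" "\<And>p. p \<in> points M \<Longrightarrow> g (alpha M y p) = v (g p)"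
    using conj_root[OF ptinf_in g(1) alpha(1)[OF assms(5)]] g(3) by metis
  have "alpha M (g y) = v"
    using v g assms(5) fix_carrier[OF g(1,3) assms(5)] v(2)[OF pt0_in] alpha(2)[OF assms(5)]
    by (intro alpha_eqI) simp_all
  then show ?thesis
    using v(2)[of x] assms fix_carrier[OF g(1,3)] by (simp add: madd carrier_pt)
qed

text \<open>Since mu_b interchanges U_infinity and U_0, the conjugate of alpha_y lies in U_0, and it
  takes infinity to y mu_b.\<close>

lemma mu_alpha:
  assumes "b \<in> U" "y \<in> R" "p \<in> points M"
  shows "mu M b (alpha M y p) = gamma (mu M b y) (mu M b p)"
proof -
  obtain v where v: "v \<in> root_group M Z" "\<And>p. p \<in> points M \<Longrightarrow> mu M b (alpha M y p) = v (mu M b p)"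
    using conj_root[OF ptinf_in mu_lpg[OF assms(1)] alpha(1)[OF assms(2)]] mu_W[OF assms(1)] by metis
  have "gamma (mu M b y) = v"
    using v(2)[OF pt0_in] v(1) mu_not_eqv_Z[OF assms(1,2)] alpha(2)[OF assms(2)] mu_Z[OF assms(1)]
    by (intro gamma_eqI) simp_all
  then show ?thesis using v(2)[OF assms(3)] by simp
qed

end

section \<open>Special local Moufang sets with abelian root groups\<close>

locale special_abelian_moufang = pointed_local_moufang_set M
  for M :: "('a, 'm) pointed_moufang_scheme" +
  fixes e :: 'a
  assumes special: "special M"
    and root_abelian: "comm_group (symg M \<lparr>carrier := root_group M (ptinf M)\<rparr>)"
    and hua_abelian: "comm_group (symg M \<lparr>carrier := hua_subgroup M\<rparr>)"
    and double_unit: "x \<in> munits M \<Longrightarrow> mdouble M x \<in> munits M"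
    and e_unit: "e \<in> munits M"
begin

abbreviation "K \<equiv> mring M e"
abbreviation kadd (infixl "\<^bold>+" 65) where "x \<^bold>+ y \<equiv> x \<oplus>\<^bsub>K\<^esub> y"
abbreviation kdiff (infixl "\<^bold>-" 65) where "x \<^bold>- y \<equiv> x \<ominus>\<^bsub>K\<^esub> y"
abbreviation kneg ("\<^bold>~ _" [80] 80) where "\<^bold>~ x \<equiv> \<ominus>\<^bsub>K\<^esub> x"
abbreviation kmult (infixl "\<^bold>*" 70) where "x \<^bold>* y \<equiv> x \<otimes>\<^bsub>K\<^esub> y"
abbreviation "\<tau> \<equiv> mu M e"

lemma K_fields [simp]: "carrier K = R" "\<zero>\<^bsub>K\<^esub> = Z" "\<one>\<^bsub>K\<^esub> = e"
  by (simp_all add: mring_def)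

lemma madd_K: "madd M x y = x \<^bold>+ y"
  by (simp add: mring_def)

section \<open>The additive group of R and its units\<close>

lemma alpha_comm:
  assumes "x \<in> R" "y \<in> R" "p \<in> points M"
  shows "alpha M x (alpha M y p) = alpha M y (alpha M x p)"
proof -
  interpret comm_group "symg M \<lparr>carrier := root_group M (ptinf M)\<rparr>" by (rule root_abelian)
  have "alpha M y \<otimes>\<^bsub>symg M\<^esub> alpha M x = alpha M x \<otimes>\<^bsub>symg M\<^esub> alpha M y"
    using m_comm[of "alpha M x" "alpha M y"] alpha assms by simp
  then show ?thesis using assms(3) by (metis eqv_sym_mult)
qed

lemma abelian_group_K: "abelian_group K"
proof (rule abelian_groupI)
  fix x y assume *: "x \<in> carrier K" "y \<in> carrier K"
  then show "x \<^bold>+ y \<in> carrier K" by (simp add: madd_K[symmetric])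
  show "x \<^bold>+ y = y \<^bold>+ x"
    using alpha_comm[of y x Z] * pt0_in by (simp add: madd_K[symmetric] madd alpha)
  fix z assume "z \<in> carrier K"
  then show "x \<^bold>+ y \<^bold>+ z = x \<^bold>+ (y \<^bold>+ z)"
    using * by (simp add: madd_K[symmetric] madd_assoc)
next
  fix x assume *: "x \<in> carrier K"
  then show "\<exists>y\<in>carrier K. y \<^bold>+ x = \<zero>\<^bsub>K\<^esub>"
    by (intro bexI[of _ "mneg M x"]) (simp_all add: madd_K[symmetric])
qed (simp_all add: madd_K[symmetric])

sublocale K: abelian_group K by (rule abelian_group_K)

lemmas K_simps [simp] = K.a_closed[unfolded K_fields] K.a_inv_closed[unfolded K_fields]
  K.minus_closed[unfolded K_fields] K.l_zero[unfolded K_fields] K.r_zero[unfolded K_fields]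
  K.l_neg[unfolded K_fields] K.r_neg[unfolded K_fields] K.add.inv_one[unfolded K_fields]
  K.minus_minus[unfolded K_fields]
lemmas K_ac = K.a_assoc[unfolded K_fields] K.a_comm[unfolded K_fields] K.a_lcomm[unfolded K_fields]
lemmas K_minus_add = K.minus_add[unfolded K_fields]
lemmas K_minus_def = K.minus_eq
lemmas K_cancel = K.r_neg1[unfolded K_fields] K.r_neg2[unfolded K_fields]
lemmas K_group = K_minus_def K_minus_add K_ac K_cancel
lemmas K_add_right_cancel [simp] = K.add.right_cancel[unfolded K_fields]

lemma K_add_left_cancel [simp]:
  "x \<in> R \<Longrightarrow> y \<in> R \<Longrightarrow> z \<in> R \<Longrightarrow> x \<^bold>+ y = x \<^bold>+ z \<longleftrightarrow> y = z"
  using K.a_comm K_fields(1) K_add_right_cancel by metis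

lemma K_diff_cancel: "x \<in> R \<Longrightarrow> y \<in> R \<Longrightarrow> x \<^bold>+ y \<^bold>- x = y"
  by (simp add: K_minus_def K.a_comm[of x] K.a_assoc)

lemma mneg_K [simp]: "x \<in> R \<Longrightarrow> mneg M x = \<^bold>~ x"
  using K.minus_equality[of "mneg M x" x] mneg_madd by (simp add: madd_K)

lemma msub_K: "x \<in> R \<Longrightarrow> y \<in> R \<Longrightarrow> msub M x y = x \<^bold>- y"
  by (simp add: msub_def madd_K K_minus_def)

lemma alpha_K: "x \<in> R \<Longrightarrow> y \<in> R \<Longrightarrow> alpha M y x = x \<^bold>+ y"
  by (simp add: madd_K[symmetric] madd)

lemma eqv_diff: "x \<in> R \<Longrightarrow> y \<in> R \<Longrightarrow> x \<sim> y \<longleftrightarrow> x \<^bold>- y \<sim> Z"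
  using eqv_translate[of x y "\<^bold>~ y"] by (simp add: madd_K K_minus_def)

lemma nonunit_add: "x \<sim> Z \<Longrightarrow> y \<sim> Z \<Longrightarrow> x \<^bold>+ y \<sim> Z"
  using eqv_translate[of x Z y] nonunit_carrier by (auto simp: madd_K intro: eqv_trans)

lemma nonunit_neg: "x \<sim> Z \<Longrightarrow> \<^bold>~ x \<sim> Z"
  using eqv_translate[of x Z "\<^bold>~ x"] nonunit_carrier eqv_commute by (simp add: madd_K)

lemma nonunit_diff: "x \<sim> Z \<Longrightarrow> y \<sim> Z \<Longrightarrow> x \<^bold>- y \<sim> Z"
  by (simp add: K_minus_def nonunit_add nonunit_neg)

lemma neg_unit [simp]: "x \<in> U \<Longrightarrow> \<^bold>~ x \<in> U"
  using mneg_unit unit_carrier by simp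

lemma unit_add_nonunit:
  assumes "x \<in> U" "y \<sim> Z" shows "x \<^bold>+ y \<in> U"
  using assms nonunit_diff[of "x \<^bold>+ y" y] nonunit_carrier[of y] unit_carrier[of x]
  by (auto simp: unit_iff K_group)

lemma twice_unit: "x \<in> U \<Longrightarrow> x \<^bold>+ x \<in> U"
  using double_unit mdouble by (simp add: unit_carrier madd_K)

text \<open>If y + x and y - x were both equivalent to 0, so would be their difference 2x, against
  (R4).\<close>

lemma unit_sum_or_diff:
  assumes "x \<in> U" "y \<in> R" "x \<^bold>+ y \<notin> U" shows "y \<^bold>- x \<in> U"
proof (rule ccontr)
  assume "\<not> ?thesis"
  then have "y \<^bold>- x \<sim> Z" "x \<^bold>+ y \<sim> Z"
    using assms unit_carrier[OF assms(1)] by (simp_all add: unit_iff)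
  then have "(x \<^bold>+ y) \<^bold>- (y \<^bold>- x) \<sim> Z" by (rule nonunit_diff[rotated])
  moreover have "(x \<^bold>+ y) \<^bold>- (y \<^bold>- x) = x \<^bold>+ x"
    using assms(2) unit_carrier[OF assms(1)]
    by (simp add: K_minus_def K_minus_add K.a_assoc K_cancel)
  ultimately show False using twice_unit[OF assms(1)] by (simp add: unit_iff)
qed

section \<open>Negation and the symmetric decompositions of mu-maps\<close>

lemma fix_add:
  assumes "g \<in> little_projective_group M" "g Z = Z" "g W = W" "x \<in> R" "y \<in> R"
  shows "g (x \<^bold>+ y) = g x \<^bold>+ g y"
  using fix_madd[OF assms] by (simp add: madd_K)

lemma fix_neg:
  assumes g: "g \<in> little_projective_group M" "g Z = Z" "g W = W" and "x \<in> R"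
  shows "g (\<^bold>~ x) = \<^bold>~ g x"
  using K.minus_equality[of "g (\<^bold>~ x)" "g x"] fix_add[OF g, of "\<^bold>~ x" x] assms
    fix_carrier[OF g(1,3)] by simp

text \<open>Specialness is given for one mu-map only. Any other mu-map is that one followed by some
  \<open>g\<close> fixing 0 and infinity, and such a \<open>g\<close> is additive.\<close>

lemma mu_neg:
  assumes "b \<in> U" "x \<in> U"
  shows "mu M b (\<^bold>~ x) = \<^bold>~ mu M b x"
proof -
  obtain b' where b': "b' \<in> U" "\<And>y. y \<in> U \<Longrightarrow> mu M b' (mneg M y) = mneg M (mu M b' y)"
    using special unfolding special_def by blast
  define g where "g = inv\<^bsub>symg M\<^esub> mu M b' \<otimes>\<^bsub>symg M\<^esub> mu M b"
  have m: "mu M b' \<in> carrier (symg M)" using lpg_carrier mu_lpg b' by blast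
  have inv: "(inv\<^bsub>symg M\<^esub> mu M b') W = Z" "(inv\<^bsub>symg M\<^esub> mu M b') Z = W"
    using eqv_sym_inv(1)[OF m pt0_in] eqv_sym_inv(1)[OF m ptinf_in] mu_Z mu_W b' by auto
  have g: "g \<in> little_projective_group M" "g Z = Z" "g W = W"
    unfolding g_def using inv pt0_in ptinf_in b' assms
    by (auto intro!: lpg_mult lpg_inv mu_lpg simp: mu_Z mu_W)
  have eq: "mu M b y = g (mu M b' y)" if "y \<in> U" for y
    using unitD(1)[OF that] unitD(1)[OF mu_unit[OF b'(1) that]] eqv_sym_inv(1)[OF m]
    by (simp add: g_def)
  have x: "x \<in> R" "mu M b' x \<in> R" using assms b' mu_unit unit_carrier by auto
  show ?thesis
    using eq[of x] eq[of "\<^bold>~ x"] b'(2)[OF assms(2)] fix_neg[OF g x(2)] assms x by simp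
qed

text \<open>gamma_x is the conjugate by \<open>\<tau>\<close> of alpha_y, where
  y\<open>\<tau>\<close> = x. Its inverse is therefore the conjugate of alpha_{-y}, which by
  specialness is gamma_{-x}.\<close>

lemma gamma_neg:
  assumes "x \<in> U" "p \<in> points M"
  shows "gamma (\<^bold>~ x) (gamma x p) = p"
proof -
  obtain y where y: "y \<in> U" "\<tau> y = x" using mu_surj_unit[OF e_unit assms(1)] by blast
  obtain q where q: "q \<in> points M" "\<tau> q = p"
    using eqv_sym_surj[OF lpg_carrier[OF mu_lpg[OF e_unit]] assms(2)] by blast
  note yR = unit_carrier[OF y(1)]
  have "gamma (\<^bold>~ x) (gamma x p) = gamma (\<tau> (\<^bold>~ y)) (gamma (\<tau> y) (\<tau> q))"
    using y q mu_neg[OF e_unit] by simp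
  also have "\<dots> = \<tau> (alpha M (\<^bold>~ y) (alpha M y q))"
    using yR q e_unit lpg_app[OF alpha_lpg] by (simp add: mu_alpha)
  also have "\<dots> = p"
    using yR q by (simp add: alpha_madd[symmetric] madd_K alpha_Z)
  finally show ?thesis .
qed

lemma gamma_neg_self: "x \<in> U \<Longrightarrow> gamma (\<^bold>~ x) x = W"
  using gamma_neg[OF _ ptinf_in] gamma(2) unitD by metis

lemma gamma_unit_pt: "x \<in> U \<Longrightarrow> p \<in> points M \<Longrightarrow> gamma x p \<in> points M"
  using lpg_app gamma_lpg unitD by metis

lemma alpha_neg: "x \<in> R \<Longrightarrow> p \<in> points M \<Longrightarrow> alpha M (\<^bold>~ x) (alpha M x p) = p"
  by (simp add: alpha_madd[symmetric] madd_K alpha_Z)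

text \<open>The last factor in \<open>mu_aux\<close>, the inverse of gamma_x, is gamma_{-x} by
  specialness.\<close>

lemma mu_eq_gamma_alpha_gamma:
  assumes "x \<in> U" "p \<in> points M"
  shows "mu M x p = gamma (\<^bold>~ x) (alpha M x (gamma (\<^bold>~ x) p))"
proof -
  have x: "\<^bold>~ x \<in> U" "\<^bold>~ \<^bold>~ x = x" using assms unit_carrier by auto
  have c: "gamma x \<in> carrier (symg M)" using lpg_carrier gamma_lpg assms unitD by metis
  have "(inv\<^bsub>symg M\<^esub> gamma x) q = gamma (\<^bold>~ x) q" if "q \<in> points M" for q
    using eqv_sym_inv(1)[OF c] gamma_neg[OF x(1) that] x gamma_unit_pt[OF x(1) that] by metis
  then show ?thesis
    using mu_aux(1)[OF assms(1)] assms x gamma_unit_pt lpg_app[OF alpha_lpg] unit_carrier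
    by (simp add: gamma_unit_pt)
qed

text \<open>Follow x through the three factors: it goes to infinity, stays there, and ends at
  -x.\<close>

lemma mu_self:
  assumes "x \<in> U" shows "mu M x x = \<^bold>~ x"
  using mu_eq_gamma_alpha_gamma[OF assms unit_pt[OF assms]] gamma_neg_self[OF assms]
    alpha_W gamma(2) unitD neg_unit assms by metis

text \<open>Conjugating gamma_{-x} alpha_x gamma_{-x}, which is mu_x, by mu_x itself changes
  nothing. As mu_x interchanges x and -x, the factors become alpha_x gamma_{-x} alpha_x.\<close>

lemma mu_eq_alpha_gamma_alpha:
  assumes x: "x \<in> U" and p: "p \<in> points M"
  shows "mu M x p = alpha M x (gamma (\<^bold>~ x) (alpha M x p))"
proof -
  have n: "\<^bold>~ x \<in> U" "x \<in> R" "\<^bold>~ \<^bold>~ x = x" using x unit_carrier by auto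
  note xs = unitD[OF x] and ns = unitD[OF n(1)]
  obtain v where v: "v \<in> root_group M W"
    "\<And>q. q \<in> points M \<Longrightarrow> mu M x (gamma (\<^bold>~ x) q) = v (mu M x q)"
    using conj_root[OF pt0_in mu_lpg[OF x] gamma(1)[OF ns(1,2)]] mu_Z[OF x] by metis
  have "v Z = x"
    using v(2)[OF ptinf_in] mu_W[OF x] gamma(2)[OF ns(1,2)] mu_neg[OF x x] mu_self[OF x] n by simp
  then have va: "alpha M x = v" using alpha_eqI[OF xs(4) v(1)] by simp
  have a: "mu M x (alpha M x q) = gamma (\<^bold>~ x) (mu M x q)" if "q \<in> points M" for q
    using mu_alpha[OF x n(2) that] mu_self[OF x] by simp
  obtain q where q: "q \<in> points M" "mu M x q = p"
    using eqv_sym_surj[OF lpg_carrier[OF mu_lpg[OF x]] p] by blast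
  have gq: "gamma (\<^bold>~ x) q \<in> points M" by (rule gamma_unit_pt[OF n(1) q(1)])
  have agq: "alpha M x (gamma (\<^bold>~ x) q) \<in> points M"
    using lpg_app[OF alpha_lpg[OF n(2)] gq] .
  have "mu M x p = mu M x (gamma (\<^bold>~ x) (alpha M x (gamma (\<^bold>~ x) q)))"
    using mu_eq_gamma_alpha_gamma[OF x q(1)] q by simp
  also have "\<dots> = alpha M x (gamma (\<^bold>~ x) (alpha M x p))"
    using v(2)[OF agq] a[OF gq] v(2)[OF q(1)] q va by simp
  finally show ?thesis .
qed

text \<open>In alpha_x gamma_{-x} alpha_x the first factor takes z to z + x = u mu_b. As gamma_{-x}
  is the conjugate of alpha_{-v} by mu_b, it takes this on to (u - v) mu_b.\<close>

lemma mu_formula: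
  assumes b: "b \<in> U" and x: "x \<in> U" and z: "z \<in> U"
    and u: "u \<in> U" "mu M b u = z \<^bold>+ x" and v: "v \<in> U" "mu M b v = x"
  shows "u \<^bold>- v \<in> U" "mu M x z = mu M b (u \<^bold>- v) \<^bold>+ x"
proof -
  note R = unit_carrier[OF x] unit_carrier[OF z] unit_carrier[OF u(1)] unit_carrier[OF v(1)]
  have "\<not> z \<^bold>+ x \<sim> Z \<^bold>+ x"
    using eqv_translate[of z Z x] R unitD[OF z] by (simp add: madd_K)
  then have "\<not> u \<sim> v"
    using lpgD(3)[OF mu_lpg[OF b], of u v] u v R carrier_pt by simp
  then show uv: "u \<^bold>- v \<in> U" using eqv_diff R by (simp add: unit_iff)
  have "mu M x z = alpha M x (gamma (mu M b (\<^bold>~ v)) (mu M b u))"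
    using mu_eq_alpha_gamma_alpha[OF x] R u v mu_neg[OF b v(1)] by (simp add: carrier_pt alpha_K)
  also have "\<dots> = alpha M x (mu M b (alpha M (\<^bold>~ v) u))"
    using mu_alpha[OF b, of "\<^bold>~ v" u] R carrier_pt by simp
  also have "\<dots> = mu M b (u \<^bold>- v) \<^bold>+ x"
    using R mu_unit[OF b uv] unit_carrier by (simp add: alpha_K K_minus_def)
  finally show "mu M x z = mu M b (u \<^bold>- v) \<^bold>+ x" .
qed

text \<open>Inverting gamma_{-x} alpha_x gamma_{-x} gives gamma_x alpha_{-x} gamma_x, which is
  mu_{-x}.\<close>

lemma mu_neg_mu:
  assumes "x \<in> U" "p \<in> points M"
  shows "mu M (\<^bold>~ x) (mu M x p) = p"
proof -
  have x: "\<^bold>~ x \<in> U" "x \<in> R" "\<^bold>~ \<^bold>~ x = x" using assms unit_carrier by auto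
  have pt: "gamma (\<^bold>~ x) p \<in> points M" using gamma_unit_pt x assms by blast
  have pt2: "alpha M x (gamma (\<^bold>~ x) p) \<in> points M" using lpg_app[OF alpha_lpg] x pt by blast
  have pt3: "mu M x p \<in> points M" using lpg_app mu_lpg assms by blast
  show ?thesis
    using mu_eq_gamma_alpha_gamma[OF x(1) pt3] mu_eq_gamma_alpha_gamma[OF assms]
      gamma_neg[OF x(1) pt2] gamma_neg[OF x(1) assms(2)] alpha_neg[OF x(2) pt] x by simp
qed

text \<open>Negating z and x negates u and v, and hence the whole value in
  \<open>mu_formula\<close>; oddness of mu_{-x} then removes the sign from z.\<close>

lemma mu_neg_index_aux:
  assumes x: "x \<in> U" and z: "z \<in> U" and s: "z \<^bold>+ x \<in> U"
  shows "mu M (\<^bold>~ x) z = mu M x z"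
proof -
  obtain u where u: "u \<in> U" "\<tau> u = z \<^bold>+ x" using mu_surj_unit[OF e_unit s] by blast
  obtain v where v: "v \<in> U" "\<tau> v = x" using mu_surj_unit[OF e_unit x] by blast
  note R = unit_carrier[OF x] unit_carrier[OF z] unit_carrier[OF u(1)] unit_carrier[OF v(1)]
  note f = mu_formula[OF e_unit x z u v]
  have "mu M (\<^bold>~ x) (\<^bold>~ z) = \<tau> (\<^bold>~ u \<^bold>- \<^bold>~ v) \<^bold>+ \<^bold>~ x"
    using x z u v R e_unit by (intro mu_formula) (auto simp: mu_neg K_minus_add)
  also have "\<^bold>~ u \<^bold>- \<^bold>~ v = \<^bold>~ (u \<^bold>- v)" using R by (simp add: K_minus_def K_minus_add)
  also have "\<tau> (\<^bold>~ (u \<^bold>- v)) \<^bold>+ \<^bold>~ x = \<^bold>~ mu M x z"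
    using f R mu_neg[OF e_unit f(1)] unit_carrier[OF mu_unit[OF e_unit f(1)]]
    by (simp add: K_minus_add)
  finally have "\<^bold>~ mu M (\<^bold>~ x) z = \<^bold>~ mu M x z" using mu_neg x z by simp
  then show ?thesis
    using K.add.inv_inj unit_carrier[OF mu_unit] x z neg_unit K.minus_minus K_fields(1) by metis
qed

text \<open>If z + x is not a unit, then z - x is one, and the auxiliary lemma applies with -x in
  place of x.\<close>

lemma mu_neg_index:
  assumes x: "x \<in> U" and z: "z \<in> U"
  shows "mu M (\<^bold>~ x) z = mu M x z"
proof (cases "z \<^bold>+ x \<in> U")
  case False
  have R: "x \<in> R" "z \<in> R" using x z unit_carrier by auto
  have "z \<^bold>+ \<^bold>~ x \<in> U"
    using unit_sum_or_diff[OF x R(2)] False R by (simp add: K_minus_def K.a_comm)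
  then show ?thesis using mu_neg_index_aux[of "\<^bold>~ x" z] x z R by simp
qed (use assms mu_neg_index_aux in blast)

text \<open>Every element of \<open>R\<close> is a difference of units, and \<open>gamma e\<close>, which commutes with \<open>g\<close>, moves
  the class of \<open>\<infinity>\<close> to that of \<open>e\<close>.\<close>

lemma fix_units_trivial:
  assumes g: "g \<in> little_projective_group M" "g Z = Z" "g W = W"
    and units: "\<And>x. x \<in> U \<Longrightarrow> g x = x" and p: "p \<in> points M"
  shows "g p = p"
proof (cases "p \<in> R")
  case True
  show ?thesis
  proof (cases "p \<in> U")
    case False
    with True have "p \<sim> Z" by (simp add: unit_iff)
    then have "e \<^bold>+ p \<in> U" using unit_add_nonunit e_unit by blast
    then show ?thesis
      using units[of "e \<^bold>+ p"] units[OF e_unit] fix_add[OF g, of e p] True unit_carrier[OF e_unit]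
        fix_carrier[OF g(1,3) True] by simp
  qed (use units in blast)
next
  case False
  then have W: "p \<sim> W" using p by (simp add: carrier_iff)
  note es = unitD[OF e_unit]
  have ge: "gamma e \<in> little_projective_group M" by (rule gamma_lpg[OF es(1,2)])
  obtain v where v: "v \<in> root_group M Z" "\<And>q. q \<in> points M \<Longrightarrow> g (gamma e q) = v (g q)"
    using conj_root[OF pt0_in g(1) gamma(1)[OF es(1,2)]] g(2) by metis
  have "v W = e" using v(2)[OF ptinf_in] g(3) gamma(2)[OF es(1,2)] units[OF e_unit] by simp
  then have "gamma e = v" using gamma_eqI[OF es(1,2) v(1)] by simp
  then have c: "g (gamma e p) = gamma e (g p)" using v(2)[OF p] by simp
  have "gamma e p \<sim> e" using lpgD(3)[OF ge p ptinf_in] W gamma(2)[OF es(1,2)] by simp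
  then have "gamma e p \<in> U"
    using es eqv_in eqv_commute eqv_trans unfolding munits_def by blast
  then have "gamma e p = gamma e (g p)" using c units by simp
  then show ?thesis using lpgD(2)[OF ge] p lpg_app[OF g(1) p] by metis
qed

text \<open>On units mu_x agrees with its inverse mu_{-x}, so its square fixes every unit as well as
  0 and infinity, which makes it trivial.\<close>

lemma mu_mu [simp]:
  assumes x: "x \<in> U" and p: "p \<in> points M"
  shows "mu M x (mu M x p) = p"
proof -
  let ?g = "mu M x \<otimes>\<^bsub>symg M\<^esub> mu M x"
  have "?g p = p"
  proof (rule fix_units_trivial[OF lpg_mult[OF mu_lpg mu_lpg, OF x x] _ _ _ p])
    fix y assume y: "y \<in> U"
    show "?g y = y"
      using mu_neg_mu[OF x unit_pt[OF y]] mu_neg_index[OF x mu_unit[OF x y]] unit_pt[OF y] by simp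
  qed (use pt0_in ptinf_in x in \<open>simp_all add: mu_Z mu_W\<close>)
  then show ?thesis using p by simp
qed

section \<open>Unique 2-divisibility of R\<close>

lemma mu_inj: "x \<in> U \<Longrightarrow> p \<in> points M \<Longrightarrow> q \<in> points M \<Longrightarrow> mu M x p = mu M x q \<longleftrightarrow> p = q"
  using mu_mu by metis

text \<open>The case z = x = a of \<open>mu_formula\<close>, with \<open>mu_self\<close>, gives -a =
  ((2a)\<open>\<tau>\<close> - a\<open>\<tau>\<close>)\<open>\<tau>\<close> + a. Applying the
  involution \<open>\<tau>\<close> yields (2a)\<open>\<tau>\<close> - a\<open>\<tau>\<close> =
  -(2a)\<open>\<tau>\<close>.\<close>

lemma half_unit:
  assumes a: "a \<in> U" shows "\<tau> (a \<^bold>+ a) \<^bold>+ \<tau> (a \<^bold>+ a) = \<tau> a"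
proof -
  let ?u = "\<tau> (a \<^bold>+ a)" and ?v = "\<tau> a"
  have uv: "?u \<in> U" "?v \<in> U" using a twice_unit mu_unit e_unit by auto
  note R = unit_carrier[OF a] unit_carrier[OF uv(1)] unit_carrier[OF uv(2)]
  have f: "?u \<^bold>- ?v \<in> U" "mu M a a = \<tau> (?u \<^bold>- ?v) \<^bold>+ a"
    using mu_formula[OF e_unit a a uv(1) _ uv(2)] a twice_unit[OF a] e_unit unit_pt by auto
  note Rf = unit_carrier[OF f(1)] unit_carrier[OF mu_unit[OF e_unit f(1)]]
  have "\<tau> (?u \<^bold>- ?v) \<^bold>+ a = \<^bold>~ a" using f mu_self[OF a] by simp
  then have "\<tau> (?u \<^bold>- ?v) \<^bold>+ a = \<^bold>~ (a \<^bold>+ a) \<^bold>+ a" using R by (simp add: K_group)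
  then have "\<tau> (?u \<^bold>- ?v) = \<^bold>~ (a \<^bold>+ a)" using R Rf by simp
  then have "?u \<^bold>- ?v = \<tau> (\<^bold>~ (a \<^bold>+ a))" using mu_mu[OF e_unit unit_pt[OF f(1)]] by simp
  then have d: "?u \<^bold>- ?v = \<^bold>~ ?u" using mu_neg[OF e_unit twice_unit[OF a]] by simp
  have "?v = ?u \<^bold>- (?u \<^bold>- ?v)" using R by (simp add: K_group)
  then show ?thesis using d R by (simp add: K_minus_def)
qed

text \<open>The difference d satisfies 2d = 0, so it is not a unit and e + d is one. Now 2(e + d) =
  2e, and \<open>half_unit\<close> recovers a\<open>\<tau>\<close> from 2a; hence e + d = e.\<close>

lemma twice_cancel:
  assumes "x \<in> R" "y \<in> R" "x \<^bold>+ x = y \<^bold>+ y" shows "x = y"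
proof -
  define d where "d = x \<^bold>- y"
  have d: "d \<in> R" "x = d \<^bold>+ y" using assms by (simp_all add: d_def K_minus_def K.a_assoc)
  note eR = unit_carrier[OF e_unit]
  have "(d \<^bold>+ d) \<^bold>+ (y \<^bold>+ y) = Z \<^bold>+ (y \<^bold>+ y)" using assms d by (simp add: K_ac)
  then have dd: "d \<^bold>+ d = Z" using d assms(2) by (subst (asm) K_add_right_cancel) auto
  then have "d \<notin> U" using twice_unit[of d] pt0_in by (auto simp: unit_iff)
  then have ed: "e \<^bold>+ d \<in> U" using unit_add_nonunit[OF e_unit] d by (simp add: unit_iff)
  have "(e \<^bold>+ d) \<^bold>+ (e \<^bold>+ d) = (e \<^bold>+ e) \<^bold>+ (d \<^bold>+ d)" using d eR by (simp add: K_ac)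
  then have "\<tau> (e \<^bold>+ d) = \<tau> e" using dd half_unit[OF ed] half_unit[OF e_unit] eR by simp
  then have "e \<^bold>+ d = e \<^bold>+ Z" using mu_inj[OF e_unit] unit_pt ed e_unit eR by simp
  then have "d = Z" using K_add_left_cancel[of e d Z] eR d by simp
  then show ?thesis using d assms by simp
qed

text \<open>A unit a is twice (2(a\<open>\<tau>\<close>))\<open>\<tau>\<close>, by
  \<open>half_unit\<close> at a\<open>\<tau>\<close>; a nonunit z is the difference of the units e +
  z and e.\<close>

lemma twice_surj:
  assumes "z \<in> R" obtains w where "w \<in> R" "w \<^bold>+ w = z"
proof -
  have *: "\<exists>w\<in>R. w \<^bold>+ w = a" if a: "a \<in> U" for a
  proof -
    have "\<tau> (\<tau> a) = a" using a e_unit unit_pt by simp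
    then show ?thesis
      using half_unit[OF mu_unit[OF e_unit a]] unit_carrier[OF mu_unit[OF e_unit twice_unit]]
        mu_unit[OF e_unit a] by metis
  qed
  show thesis
  proof (cases "z \<in> U")
    case False
    then have "e \<^bold>+ z \<in> U" using unit_add_nonunit[OF e_unit] assms by (simp add: unit_iff)
    then obtain u v where uv: "u \<in> R" "u \<^bold>+ u = e \<^bold>+ z" "v \<in> R" "v \<^bold>+ v = e"
      using * e_unit by metis
    have "(u \<^bold>- v) \<^bold>+ (u \<^bold>- v) = (u \<^bold>+ u) \<^bold>- (v \<^bold>+ v)" using uv(1,3) by (simp add: K_group)
    also have "\<dots> = z" using uv assms unit_carrier[OF e_unit] by (simp add: K_diff_cancel)
    finally show thesis using that[of "u \<^bold>- v"] uv by simp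
  qed (use * that in blast)
qed

lemma mhalf: "z \<in> R \<Longrightarrow> mhalf M z \<in> R" "z \<in> R \<Longrightarrow> mhalf M z \<^bold>+ mhalf M z = z"
proof -
  assume z: "z \<in> R"
  have "\<exists>!w. w \<in> R \<and> madd M w w = z"
    using twice_surj[OF z] twice_cancel unfolding madd_K by metis
  from theI'[OF this] show "mhalf M z \<in> R" "mhalf M z \<^bold>+ mhalf M z = z"
    unfolding mhalf_def madd_K by auto
qed

end

section \<open>The Hua maps and the ring\<close>

context special_abelian_moufang
begin

section \<open>Hua maps and the additive maps commuting with them\<close>

abbreviation "h \<equiv> hua M e"

lemma hua_app [simp]: "p \<in> points M \<Longrightarrow> h w p = mu M w (\<tau> p)"
  by (simp add: hua_def)

lemma hua_fix:
  assumes "w \<in> U"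
  shows "h w \<in> little_projective_group M" "h w Z = Z" "h w W = W"
  using assms e_unit pt0_in ptinf_in
  by (auto simp: mu_Z mu_W hua_def[of M e w] intro!: lpg_mult mu_lpg)

lemmas hua_closed [simp] = fix_carrier[OF hua_fix(1,3)]
lemmas hua_add = fix_add[OF hua_fix]

lemma hua_comm:
  assumes "w \<in> U" "w' \<in> U" "p \<in> points M"
  shows "h w (h w' p) = h w' (h w p)"
proof -
  interpret H: comm_group "symg M \<lparr>carrier := hua_subgroup M\<rparr>" by (rule hua_abelian)
  have "h v \<in> hua_subgroup M" if "v \<in> U" for v
    unfolding hua_subgroup_def hua_def using e_unit that by (blast intro: generate.incl)
  then have "h w' \<otimes>\<^bsub>symg M\<^esub> h w = h w \<otimes>\<^bsub>symg M\<^esub> h w'"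
    using H.m_comm[of "h w'" "h w"] assms by simp
  then show ?thesis using assms(3) by (metis eqv_sym_mult)
qed

text \<open>Since H is abelian, this class contains the Hua maps; being closed under sums and
  differences, it contains every R_y, and its members commute with every R_y. Only values on R
  count, as addition lives there.\<close>

definition hua_linear :: "('a \<Rightarrow> 'a) \<Rightarrow> bool"
  where "hua_linear A \<longleftrightarrow> (\<forall>x\<in>R. A x \<in> R) \<and> (\<forall>x\<in>R. \<forall>y\<in>R. A (x \<^bold>+ y) = A x \<^bold>+ A y) \<and>
    (\<forall>w\<in>U. \<forall>x\<in>R. A (h w x) = h w (A x))"

lemma hua_linearI:
  assumes "\<And>x. x \<in> R \<Longrightarrow> A x \<in> R" "\<And>x y. x \<in> R \<Longrightarrow> y \<in> R \<Longrightarrow> A (x \<^bold>+ y) = A x \<^bold>+ A y"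
    "\<And>w x. w \<in> U \<Longrightarrow> x \<in> R \<Longrightarrow> A (h w x) = h w (A x)"
  shows "hua_linear A"
  using assms unfolding hua_linear_def by blast

lemma hua_linearD:
  assumes "hua_linear A" "x \<in> R"
  shows "A x \<in> R" "y \<in> R \<Longrightarrow> A (x \<^bold>+ y) = A x \<^bold>+ A y" "w \<in> U \<Longrightarrow> A (h w x) = h w (A x)"
  using assms unfolding hua_linear_def by blast+

lemma hua_linear_neg:
  assumes "hua_linear A" "x \<in> R" shows "A (\<^bold>~ x) = \<^bold>~ A x"
proof -
  note A = hua_linearD[OF assms(1)]
  have "A Z \<^bold>+ A Z = Z \<^bold>+ A Z" using A(2)[of Z Z] A(1)[of Z] by simp
  then have "A Z = Z" using A(1)[of Z] K_add_right_cancel[of "A Z" "A Z" Z] by simp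
  then show ?thesis
    using K.minus_equality[of "A (\<^bold>~ x)" "A x"] A(2)[of "\<^bold>~ x" x] A(1) assms(2) by simp
qed

lemma hua_linear_diff: "hua_linear A \<Longrightarrow> x \<in> R \<Longrightarrow> y \<in> R \<Longrightarrow> A (x \<^bold>- y) = A x \<^bold>- A y"
  by (simp add: K_minus_def hua_linearD(2) hua_linear_neg)

lemma hua_linear_hua:
  assumes "w \<in> U" shows "hua_linear (h w)"
  by (rule hua_linearI) (use assms hua_add hua_comm carrier_pt hua_closed in blast)+

lemma hua_linear_id: "hua_linear (\<lambda>x. x)"
  by (rule hua_linearI) auto

lemma hua_linear_plus:
  assumes "hua_linear A" "hua_linear B" shows "hua_linear (\<lambda>x. A x \<^bold>+ B x)"
proof (rule hua_linearI)
  note A = hua_linearD[OF assms(1)] and B = hua_linearD[OF assms(2)]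
  show "A x \<^bold>+ B x \<in> R" if "x \<in> R" for x using A B that by simp
  show "A (x \<^bold>+ y) \<^bold>+ B (x \<^bold>+ y) = A x \<^bold>+ B x \<^bold>+ (A y \<^bold>+ B y)" if "x \<in> R" "y \<in> R" for x y
    using A B that by (simp add: K_ac)
  show "A (h w x) \<^bold>+ B (h w x) = h w (A x \<^bold>+ B x)" if "w \<in> U" "x \<in> R" for w x
    using A B that by (simp add: hua_add del: hua_app)
qed

lemma hua_linear_uminus:
  assumes "hua_linear A" shows "hua_linear (\<lambda>x. \<^bold>~ A x)"
proof (rule hua_linearI)
  note A = hua_linearD[OF assms]
  show "\<^bold>~ A x \<in> R" if "x \<in> R" for x using A that by simp
  show "\<^bold>~ A (x \<^bold>+ y) = \<^bold>~ A x \<^bold>+ \<^bold>~ A y" if "x \<in> R" "y \<in> R" for x y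
    using A that by (simp add: K_minus_add)
  show "\<^bold>~ A (h w x) = h w (\<^bold>~ A x)" if "w \<in> U" "x \<in> R" for w x
    using A that fix_neg[OF hua_fix] by (simp del: hua_app)
qed

lemma hua_linear_minus:
  assumes "hua_linear A" "hua_linear B" shows "hua_linear (\<lambda>x. A x \<^bold>- B x)"
  unfolding K_minus_def using assms by (intro hua_linear_plus hua_linear_uminus)

section \<open>The maps R_y\<close>

lemma index_cases:
  assumes "y \<in> R"
  obtains (sum) "y \<in> U" "e \<^bold>+ y \<in> U"
  | (diff) "y \<in> U" "e \<^bold>+ y \<notin> U" "\<^bold>~ e \<^bold>+ y \<in> U"
  | (nonunit) "y \<notin> U" "e \<^bold>+ y \<in> U" "e \<^bold>+ e \<^bold>+ y \<in> U"
proof -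
  have eR: "e \<in> R" using e_unit unit_carrier by blast
  consider "y \<in> U" "e \<^bold>+ y \<in> U" | "y \<in> U" "e \<^bold>+ y \<notin> U" | "y \<notin> U" by blast
  then show thesis
  proof cases
    case 2
    \<comment> \<open>Since 2e is a unit, e + y and y - e cannot both be nonunits.\<close>
    then have "y \<^bold>- e \<in> U" using unit_sum_or_diff[OF e_unit assms] by blast
    then show ?thesis using diff 2 assms eR by (simp add: K_minus_def K.a_comm)
  next
    case 3
    then have "y \<sim> Z" using assms by (simp add: unit_iff)
    then show ?thesis
      using nonunit 3 unit_add_nonunit e_unit twice_unit[OF e_unit] by blast
  qed (rule sum)
qed

lemma rmap_simps:
  assumes "x \<in> R" "y \<in> R"
  shows "y \<in> U \<Longrightarrow> e \<^bold>+ y \<in> U \<Longrightarrow> rmap M e y x = h (e \<^bold>+ y) x \<^bold>- h y x \<^bold>- x"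
    "y \<in> U \<Longrightarrow> e \<^bold>+ y \<notin> U \<Longrightarrow> \<^bold>~ e \<^bold>+ y \<in> U \<Longrightarrow>
      rmap M e y x = \<^bold>~ h (\<^bold>~ e \<^bold>+ y) x \<^bold>+ x \<^bold>+ h y x"
    "y \<notin> U \<Longrightarrow> e \<^bold>+ y \<in> U \<Longrightarrow> e \<^bold>+ e \<^bold>+ y \<in> U \<Longrightarrow>
      rmap M e y x = h (e \<^bold>+ e \<^bold>+ y) x \<^bold>- h (e \<^bold>+ y) x \<^bold>- h (\<^bold>~ (e \<^bold>+ e)) x \<^bold>+ x"
proof -
  have eR: "e \<in> R" using e_unit unit_carrier by blast
  have c: "y \<^bold>+ e = e \<^bold>+ y" using K.a_comm eR assms by simp
  show "y \<in> U \<Longrightarrow> e \<^bold>+ y \<in> U \<Longrightarrow> rmap M e y x = h (e \<^bold>+ y) x \<^bold>- h y x \<^bold>- x"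
    "y \<in> U \<Longrightarrow> e \<^bold>+ y \<notin> U \<Longrightarrow> \<^bold>~ e \<^bold>+ y \<in> U \<Longrightarrow>
      rmap M e y x = \<^bold>~ h (\<^bold>~ e \<^bold>+ y) x \<^bold>+ x \<^bold>+ h y x"
    "y \<notin> U \<Longrightarrow> e \<^bold>+ y \<in> U \<Longrightarrow> e \<^bold>+ e \<^bold>+ y \<in> U \<Longrightarrow>
      rmap M e y x = h (e \<^bold>+ e \<^bold>+ y) x \<^bold>- h (e \<^bold>+ y) x \<^bold>- h (\<^bold>~ (e \<^bold>+ e)) x \<^bold>+ x"
    using assms eR c twice_unit[OF e_unit]
    by (simp_all add: rmap_def madd_K msub_K del: hua_app)
qed

lemma hua_linear_rmap:
  assumes y: "y \<in> R" shows "hua_linear (rmap M e y)"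
proof -
  \<comment> \<open>Being \<open>hua_linear\<close> depends only on the values on R, where the case
    formulas for \<open>rmap\<close> are available.\<close>
  have cong: "hua_linear (rmap M e y)" if "hua_linear A" "\<And>x. x \<in> R \<Longrightarrow> rmap M e y x = A x" for A
    using hua_linearD[OF that(1)] that(2)
    by (intro hua_linearI) (simp_all del: hua_app add: hua_closed)
  have ee: "\<^bold>~ (e \<^bold>+ e) \<in> U" using twice_unit e_unit by simp
  note intros = hua_linear_plus hua_linear_minus hua_linear_uminus hua_linear_hua hua_linear_id
  from y show ?thesis
  proof (cases rule: index_cases)
    case sum
    show ?thesis by (rule cong[OF _ rmap_simps(1)[OF _ y sum]]) (use sum in \<open>intro intros; simp\<close>)
  next
    case diff
    show ?thesis by (rule cong[OF _ rmap_simps(2)[OF _ y diff]]) (use diff in \<open>intro intros; simp\<close>)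
  next
    case nonunit
    show ?thesis
      by (rule cong[OF _ rmap_simps(3)[OF _ y nonunit]]) (use nonunit ee in \<open>intro intros; simp\<close>)
  qed
qed

text \<open>Each case of R_y is a signed sum of Hua maps and possibly the identity, and
  \<open>A\<close> passes through every term.\<close>

lemma hua_linear_rmap_comm:
  assumes A: "hua_linear A" and x: "x \<in> R" and y: "y \<in> R"
  shows "A (rmap M e y x) = rmap M e y (A x)"
proof -
  have ee: "\<^bold>~ (e \<^bold>+ e) \<in> U" using twice_unit e_unit by simp
  note Ax = hua_linearD(1)[OF A x]
  note rules = hua_linearD(2,3)[OF A] hua_linear_neg[OF A] hua_linear_diff[OF A] Ax x
  from y show ?thesis
  proof (cases rule: index_cases)
    case sum
    then show ?thesis
      unfolding rmap_simps(1)[OF x y sum] rmap_simps(1)[OF Ax y sum]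
      by (simp del: hua_app add: rules)
  next
    case diff
    then show ?thesis
      unfolding rmap_simps(2)[OF x y diff] rmap_simps(2)[OF Ax y diff]
      by (simp del: hua_app add: rules)
  next
    case nonunit
    then show ?thesis
      unfolding rmap_simps(3)[OF x y nonunit] rmap_simps(3)[OF Ax y nonunit]
      using ee by (simp del: hua_app add: rules)
  qed
qed

text \<open>\<open>mu_formula\<close> evaluates (-f) mu_{f+y} and f mu_y from the same preimages
  y\<open>\<tau>\<close> and (f + y)\<open>\<tau>\<close>, taken in opposite order. The values are t
  + f + y and -t + y, and t is eliminated.\<close>

lemma mu_shift:
  assumes f: "f \<in> U" and y: "y \<in> U" and fy: "f \<^bold>+ y \<in> U"
  shows "mu M y f = mu M (f \<^bold>+ y) f \<^bold>+ (f \<^bold>+ (y \<^bold>+ y))"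
proof -
  let ?u = "\<tau> y" and ?v = "\<tau> (f \<^bold>+ y)"
  have uv: "?u \<in> U" "?v \<in> U" "\<tau> ?u = y" "\<tau> ?v = f \<^bold>+ y"
    using mu_unit[OF e_unit] mu_mu[OF e_unit] y fy unit_pt by auto
  note R = unitD(4)[OF f] unitD(4)[OF y] unitD(4)[OF uv(1)] unitD(4)[OF uv(2)]
  have "mu M (f \<^bold>+ y) (\<^bold>~ f) = \<tau> (?u \<^bold>- ?v) \<^bold>+ (f \<^bold>+ y)" and t: "?u \<^bold>- ?v \<in> U"
    using mu_formula[OF e_unit fy neg_unit[OF f] uv(1) _ uv(2,4)] uv R by (simp_all add: K_cancel)
  moreover define t where "t = \<tau> (?u \<^bold>- ?v)"
  ultimately have 1: "\<^bold>~ mu M (f \<^bold>+ y) f = t \<^bold>+ (f \<^bold>+ y)" using mu_neg[OF fy f] by simp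
  have tR: "t \<in> R" unfolding t_def using t mu_unit e_unit unit_carrier by blast
  have "?v \<^bold>- ?u = \<^bold>~ (?u \<^bold>- ?v)" using R by (simp add: K_group)
  then have 2: "mu M y f = \<^bold>~ t \<^bold>+ y"
    using mu_formula(2)[OF e_unit y f uv(2,4) uv(1,3)] mu_neg[OF e_unit t] by (simp add: t_def)
  have "mu M (f \<^bold>+ y) f = \<^bold>~ (t \<^bold>+ (f \<^bold>+ y))"
    using 1 K.minus_minus unitD(4)[OF mu_unit[OF fy f]] by (metis K_fields(1))
  then have "mu M (f \<^bold>+ y) f \<^bold>+ (f \<^bold>+ (y \<^bold>+ y)) = (\<^bold>~ t \<^bold>+ \<^bold>~ (f \<^bold>+ y)) \<^bold>+ ((f \<^bold>+ y) \<^bold>+ y)"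
    using R tR by (simp add: K.a_assoc K.minus_add)
  also have "\<dots> = \<^bold>~ t \<^bold>+ y"
    using R tR by (simp add: K.a_assoc[of "\<^bold>~ t"] K.r_neg1)
  finally show ?thesis using 2 by simp
qed

lemma hua_e:
  assumes "w \<in> U" shows "h w e = \<^bold>~ mu M w e"
  using assms e_unit mu_self[OF e_unit] mu_neg[OF assms e_unit] by (simp add: unit_pt)

text \<open>As e\<open>\<tau>\<close> = -e, every e h_w is -(e mu_w). The formulas for R_y combine
  such values at indices differing by e, which \<open>mu_shift\<close> with f = e or f = -e
  compares.\<close>

lemma rmap_e:
  assumes y: "y \<in> R" shows "rmap M e y e = y \<^bold>+ y"
proof -
  have eR: "e \<in> R" using e_unit unit_carrier by blast
  have muR: "mu M w e \<in> R" if "w \<in> U" for w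
    using mu_unit[OF that e_unit] unit_carrier by blast
  from y show ?thesis
  proof (cases rule: index_cases)
    case sum
    let ?m = "mu M (e \<^bold>+ y) e"
    have "rmap M e y e = \<^bold>~ ?m \<^bold>- \<^bold>~ (?m \<^bold>+ (e \<^bold>+ (y \<^bold>+ y))) \<^bold>- e"
      using rmap_simps(1)[OF eR y sum] mu_shift[OF e_unit sum] sum by (simp add: hua_e del: hua_app)
    also have "\<dots> = (e \<^bold>+ (y \<^bold>+ y)) \<^bold>- e"
      using eR y muR[OF sum(2)] by (simp add: K_minus_def K.r_neg1)
    also have "\<dots> = y \<^bold>+ y" using eR y by (simp add: K_diff_cancel)
    finally show ?thesis .
  next
    case diff
    let ?m = "mu M (\<^bold>~ e \<^bold>+ y) e"
    have "\<^bold>~ mu M y e = \<^bold>~ ?m \<^bold>+ (\<^bold>~ e \<^bold>+ (y \<^bold>+ y))"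
      using mu_shift[OF neg_unit[OF e_unit] diff(1,3)] mu_neg e_unit diff by simp
    then have "rmap M e y e = ?m \<^bold>+ e \<^bold>+ (\<^bold>~ ?m \<^bold>+ (\<^bold>~ e \<^bold>+ (y \<^bold>+ y)))"
      using rmap_simps(2)[OF eR y diff] diff muR by (simp add: hua_e del: hua_app)
    also have "\<dots> = (?m \<^bold>+ e) \<^bold>+ (\<^bold>~ (?m \<^bold>+ e) \<^bold>+ (y \<^bold>+ y))"
      using muR[OF diff(3)] eR y by (simp add: K_minus_add K.a_assoc)
    also have "\<dots> = y \<^bold>+ y" using muR[OF diff(3)] eR y by (simp add: K.r_neg2)
    finally show ?thesis .
  next
    case nonunit
    let ?p = "e \<^bold>+ y" and ?q = "e \<^bold>+ e"
    have ep: "e \<^bold>+ ?p = ?q \<^bold>+ y" and q: "?q \<in> U" "?q \<in> R"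
      using eR y twice_unit[OF e_unit] by (simp_all add: K.a_assoc)
    let ?m = "mu M (?q \<^bold>+ y) e"
    have mp: "mu M ?p e = ?m \<^bold>+ (e \<^bold>+ (?p \<^bold>+ ?p))"
      using mu_shift[OF e_unit nonunit(2)] nonunit(3) ep by simp
    \<comment> \<open>The shift from index e to 2e starts at e mu_e = -e and yields e h_{-2e} =
      4e.\<close>
    have "\<^bold>~ e = mu M ?q e \<^bold>+ (e \<^bold>+ ?q)"
      using mu_shift[OF e_unit e_unit q(1)] mu_self[OF e_unit] by simp
    then have "\<^bold>~ e \<^bold>- (e \<^bold>+ ?q) = mu M ?q e"
      using muR[OF q(1)] q eR by (simp add: K_minus_def K.a_assoc K.r_neg)
    then have "\<^bold>~ (\<^bold>~ e \<^bold>- (e \<^bold>+ ?q)) = \<^bold>~ mu M ?q e" by simp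
    moreover have "\<^bold>~ (\<^bold>~ e \<^bold>- (e \<^bold>+ ?q)) = e \<^bold>+ (e \<^bold>+ ?q)"
      using eR by (simp add: K_minus_def K.minus_add)
    ultimately have "h (\<^bold>~ ?q) e = ?q \<^bold>+ ?q"
      using eR q mu_neg_index[OF q(1) e_unit] by (simp add: hua_e K.a_assoc del: hua_app)
    then have "rmap M e y e = (\<^bold>~ ?m \<^bold>- \<^bold>~ (?m \<^bold>+ (e \<^bold>+ (?p \<^bold>+ ?p)))) \<^bold>- (?q \<^bold>+ ?q) \<^bold>+ e"
      using rmap_simps(3)[OF eR y nonunit] nonunit mp by (simp add: hua_e del: hua_app)
    also have "\<^bold>~ ?m \<^bold>- \<^bold>~ (?m \<^bold>+ (e \<^bold>+ (?p \<^bold>+ ?p))) = e \<^bold>+ (?p \<^bold>+ ?p)"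
      using eR y muR[OF nonunit(3)] by (simp add: K_minus_def K.r_neg1)
    also have "(e \<^bold>+ (?p \<^bold>+ ?p)) \<^bold>- (?q \<^bold>+ ?q) \<^bold>+ e = (?q \<^bold>+ ?q) \<^bold>+ (y \<^bold>+ y) \<^bold>- (?q \<^bold>+ ?q)"
      using eR y by (simp add: K_minus_def K_ac)
    also have "\<dots> = y \<^bold>+ y" using eR y by (simp add: K_diff_cancel)
    finally show ?thesis .
  qed
qed

lemma rmap_closed [simp]: "x \<in> R \<Longrightarrow> y \<in> R \<Longrightarrow> rmap M e y x \<in> R"
  using hua_linearD(1) hua_linear_rmap by blast

text \<open>At e the commuting maps give (2x) R_y = (2y) R_x; additivity pulls out the factor 2,
  which then cancels.\<close>

lemma rmap_comm:
  assumes x: "x \<in> R" and y: "y \<in> R" shows "rmap M e y x = rmap M e x y"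
proof -
  have eR: "e \<in> R" using e_unit unit_carrier by blast
  have "rmap M e y (rmap M e x e) = rmap M e x (rmap M e y e)"
    using hua_linear_rmap_comm[OF hua_linear_rmap[OF y] eR x] .
  then have "rmap M e y x \<^bold>+ rmap M e y x = rmap M e x y \<^bold>+ rmap M e x y"
    using x y hua_linearD(2)[OF hua_linear_rmap] by (simp add: rmap_e)
  then show ?thesis by (rule twice_cancel[OF rmap_closed[OF x y] rmap_closed[OF y x]])
qed

section \<open>Multiplication and the ring axioms\<close>

lemma mult_closed [simp]: "x \<in> R \<Longrightarrow> y \<in> R \<Longrightarrow> x \<^bold>* y \<in> R"
  and mult_twice: "x \<in> R \<Longrightarrow> y \<in> R \<Longrightarrow> x \<^bold>* y \<^bold>+ x \<^bold>* y = rmap M e y x"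
  using mhalf[of "rmap M e y x"] by (simp_all add: mring_def)

lemma mult_eqI: "x \<in> R \<Longrightarrow> y \<in> R \<Longrightarrow> z \<in> R \<Longrightarrow> rmap M e y x = z \<^bold>+ z \<Longrightarrow> x \<^bold>* y = z"
  using twice_cancel mult_twice mult_closed by metis

lemma mult_comm: "x \<in> R \<Longrightarrow> y \<in> R \<Longrightarrow> x \<^bold>* y = y \<^bold>* x"
  using rmap_comm by (simp add: mring_def)

lemma mult_distrib: "x \<in> R \<Longrightarrow> y \<in> R \<Longrightarrow> z \<in> R \<Longrightarrow> (x \<^bold>+ y) \<^bold>* z = x \<^bold>* z \<^bold>+ y \<^bold>* z"
  using hua_linearD(2)[OF hua_linear_rmap, of z x y]
  by (intro mult_eqI) (simp_all add: mult_twice[symmetric] K_ac)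

text \<open>\<open>A\<close> commutes with R_y and, being additive, with halving. Associativity will
  come from taking \<open>A\<close> to be a multiplication map.\<close>

lemma hua_linear_mult:
  assumes A: "hua_linear A" and x: "x \<in> R" and y: "y \<in> R"
  shows "A (x \<^bold>* y) = A x \<^bold>* y"
  using hua_linear_rmap_comm[OF assms] hua_linearD(1,2)[OF A] x y
  by (intro mult_eqI[symmetric]) (simp_all add: mult_twice[symmetric])

lemma hua_linear_right_mult: "z \<in> R \<Longrightarrow> hua_linear (\<lambda>x. x \<^bold>* z)"
  using hua_linear_mult[OF hua_linear_hua] by (intro hua_linearI) (simp_all add: mult_distrib del: hua_app)

lemma mult_one: "y \<in> R \<Longrightarrow> e \<^bold>* y = y"
  using e_unit unit_carrier rmap_e by (intro mult_eqI) auto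

lemma cring_K: "cring K"
proof (rule cringI[OF abelian_group_K])
  show "comm_monoid K"
  proof (rule comm_monoidI)
    fix x y z assume "x \<in> carrier K" "y \<in> carrier K" "z \<in> carrier K"
    \<comment> \<open>\<open>hua_linear_mult\<close> for multiplication by z reads (yx)z = (yz)x;
      commutativity turns this into associativity.\<close>
    then show "x \<^bold>* y \<^bold>* z = x \<^bold>* (y \<^bold>* z)"
      using hua_linear_mult[OF hua_linear_right_mult, of z y x] mult_comm[of x y]
        mult_comm[of x "y \<^bold>* z"] by simp
  qed (use e_unit unit_carrier mult_one mult_comm in auto)
qed (simp add: mult_distrib)

section \<open>Inverses and the maximal ideal\<close>

sublocale K: cring K by (rule cring_K)

text \<open>Because \<open>\<tau>\<close> is an involution, (x\<open>\<tau>\<close>) h_w = x mu_w,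
  so (x\<open>\<tau>\<close>) R_x = x mu_{e+x} - x mu_x - x\<open>\<tau>\<close>. Here x mu_x = -x,
  and \<open>mu_shift\<close> with f = x, y = e expresses x\<open>\<tau>\<close> through x mu_{e+x},
  leaving -2e.\<close>

lemma mult_tau_aux:
  assumes x: "x \<in> U" and ex: "e \<^bold>+ x \<in> U"
  shows "\<tau> x \<^bold>* x = \<^bold>~ e"
proof -
  have eR: "e \<in> R" and R: "x \<in> R" "\<tau> x \<in> R" "\<tau> x \<in> points M" "x \<in> points M"
    and mR: "mu M (x \<^bold>+ e) x \<in> R" and c: "e \<^bold>+ x = x \<^bold>+ e"
    using e_unit x ex unit_carrier mu_unit unit_pt K.a_comm[of e x] by auto
  let ?m = "mu M (x \<^bold>+ e) x"
  have "rmap M e x (\<tau> x) = ?m \<^bold>- \<^bold>~ x \<^bold>- \<tau> x"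
    using rmap_simps(1)[OF R(2,1) x ex] R mu_self[OF x] e_unit c by simp
  also have "\<dots> = (?m \<^bold>+ x) \<^bold>- ((?m \<^bold>+ x) \<^bold>+ (e \<^bold>+ e))"
    using mu_shift[OF x e_unit] ex c R mR eR by (simp add: K_minus_def K.a_assoc)
  also have "\<dots> = \<^bold>~ e \<^bold>+ \<^bold>~ e"
    using R mR eR by (simp add: K_minus_def K.minus_add[of "_ \<^bold>+ _"] K.r_neg2 K_minus_add[of e])
  finally show ?thesis using R eR by (intro mult_eqI) auto
qed

text \<open>If e + x is not a unit, e - x is one; the auxiliary lemma for -x suffices, since the two
  signs cancel.\<close>

lemma mult_tau:
  assumes x: "x \<in> U" shows "\<tau> x \<^bold>* x = \<^bold>~ e"
proof (cases "e \<^bold>+ x \<in> U")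
  case False
  have R: "e \<in> R" "x \<in> R" "\<tau> x \<in> R" using x e_unit mu_unit unit_carrier by auto
  then have "\<^bold>~ (x \<^bold>- e) \<in> U" using unit_sum_or_diff[OF e_unit R(2) False] neg_unit by blast
  moreover have "\<^bold>~ (x \<^bold>- e) = e \<^bold>+ \<^bold>~ x" using R by (simp add: K_group)
  ultimately have "\<tau> (\<^bold>~ x) \<^bold>* \<^bold>~ x = \<^bold>~ e" using mult_tau_aux x by simp
  then show ?thesis using mu_neg[OF e_unit x] R by (simp add: K.l_minus K.r_minus)
qed (use assms mult_tau_aux in blast)

text \<open>Hua maps fix 0 and preserve the equivalence, so R_y maps the class of 0 into itself.
  Thus 2(xy) lies in that class, and by (R4) so does xy.\<close>

lemma nonunit_mult:
  assumes x: "x \<sim> Z" and y: "y \<in> R" shows "x \<^bold>* y \<sim> Z"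
proof -
  note xR = nonunit_carrier[OF x]
  have hx: "h w x \<sim> Z" if "w \<in> U" for w
    using lpgD(3)[OF hua_fix(1)[OF that] carrier_pt[OF xR] pt0_in] hua_fix(2)[OF that] x
    by (simp del: hua_app)
  have ee: "\<^bold>~ (e \<^bold>+ e) \<in> U" using twice_unit e_unit by simp
  note rules = nonunit_add nonunit_diff nonunit_neg hx x
  have "rmap M e y x \<sim> Z"
    using y
  proof (cases rule: index_cases)
    case sum
    show ?thesis unfolding rmap_simps(1)[OF xR y sum] by (intro rules sum)
  next
    case diff
    show ?thesis unfolding rmap_simps(2)[OF xR y diff] by (intro rules diff)
  next
    case nonunit
    show ?thesis unfolding rmap_simps(3)[OF xR y nonunit] by (intro rules nonunit ee)
  qed
  then show ?thesis
    using mult_twice[OF xR y] twice_unit[of "x \<^bold>* y"] xR y by (auto simp: unit_iff)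
qed

lemma Units_K: "Units K = U"
proof
  show "U \<subseteq> Units K"
  proof
    fix x assume x: "x \<in> U"
    have R: "e \<in> R" "x \<in> R" "\<tau> x \<in> R" using x e_unit mu_unit unit_carrier by auto
    have "\<^bold>~ \<tau> x \<^bold>* x = e" using mult_tau[OF x] R by (simp add: K.l_minus)
    then show "x \<in> Units K"
      unfolding Units_def using R mult_comm[of x "\<^bold>~ \<tau> x"] by auto
  qed
  show "Units K \<subseteq> U"
  proof
    fix x assume "x \<in> Units K"
    then obtain y where "x \<in> R" "y \<in> R" "x \<^bold>* y = e" unfolding Units_def by auto
    then show "x \<in> U" using nonunit_mult[of x y] unitD[OF e_unit] by (auto simp: unit_iff)
  qed
qed

lemma nonunits_K: "carrier K - Units K = {x. x \<sim> Z}"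
  using nonunit_carrier by (auto simp: Units_K unit_iff)

lemma ideal_nonunits_K: "ideal (carrier K - Units K) K"
proof (rule idealI)
  show "ring K" by (rule K.ring_axioms)
  show "subgroup (carrier K - Units K) (add_monoid K)"
    unfolding nonunits_K
  proof (rule subgroup.intro)
    show "inv\<^bsub>add_monoid K\<^esub> x \<in> {x. x \<sim> Z}" if "x \<in> {x. x \<sim> Z}" for x
      using that nonunit_neg by (simp add: a_inv_def)
  qed (use nonunit_carrier nonunit_add pt0_in in auto)
qed (use nonunit_mult nonunits_K mult_comm nonunit_carrier in \<open>auto simp: nonunits_K\<close>)

end

section \<open>The projective line over a local ring\<close>

text \<open>Locality is expressed through the nonunits; \<open>max_ideal_eq\<close> links this form
  to the unique maximal ideal.\<close>

locale local_ring = cring +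
  assumes ideal_nonunits: "ideal (carrier R - Units R) R"
begin

text \<open>A proper ideal contains no unit, so the ideal of nonunits contains every maximal ideal
  and therefore equals it. This justifies the description operator in
  \<open>max_ideal\<close>.\<close>

lemma max_ideal_eq: "max_ideal R = carrier R - Units R"
  unfolding max_ideal_def
proof (rule the_equality)
  interpret N: ideal "carrier R - Units R" R by (rule ideal_nonunits)
  have unit: "J = carrier R" if "ideal J R" "x \<in> J" "x \<in> Units R" for J x
    using ideal.I_r_closed[OF that(1,2), of "inv x"] that(3) ideal.one_imp_carrier[OF that(1)] by simp
  show "maximalideal (carrier R - Units R) R"
  proof (rule maximalidealI[OF ideal_nonunits])
    show "carrier R \<noteq> carrier R - Units R" using one_closed Units_one_closed by blast
    fix J assume "ideal J R" "carrier R - Units R \<subseteq> J" "J \<subseteq> carrier R"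
    then show "J = carrier R - Units R \<or> J = carrier R" using unit by blast
  qed
  fix J assume J: "maximalideal J R"
  then interpret J: maximalideal J R .
  have "J \<subseteq> carrier R - Units R"
    using unit[OF J.ideal_axioms] J.I_notcarr J.Icarr by blast
  then show "J = carrier R - Units R"
    using J.I_maximal[OF ideal_nonunits] one_closed Units_one_closed by blast
qed

lemma nonunit_mult_closed:
  "x \<in> carrier R - Units R \<Longrightarrow> y \<in> carrier R \<Longrightarrow> x \<otimes> y \<in> carrier R - Units R"
  using ideal.I_r_closed[OF ideal_nonunits] by blast

lemma nonunit_add_closed:
  "x \<in> carrier R - Units R \<Longrightarrow> y \<in> carrier R - Units R \<Longrightarrow> x \<oplus> y \<in> carrier R - Units R"
  using additive_subgroup.a_closed[OF ideal.axioms(1)[OF ideal_nonunits]] by blast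

lemma proj_pt_scale:
  assumes "a \<in> carrier R" "b \<in> carrier R" "u \<in> Units R"
  shows "proj_pt R (a \<otimes> u) (b \<otimes> u) = proj_pt R a b"
proof -
  have "(\<lambda>v. (a \<otimes> v, b \<otimes> v)) ` (\<lambda>v. u \<otimes> v) ` Units R = (\<lambda>v. (a \<otimes> v, b \<otimes> v)) ` Units R"
  proof -
    have "v = u \<otimes> (inv u \<otimes> v)" if "v \<in> Units R" for v
      using assms(3) that by (simp add: m_assoc[symmetric] Units_closed)
    moreover have "inv u \<otimes> v \<in> Units R" if "v \<in> Units R" for v
      using assms(3) that by simp
    ultimately have "(\<lambda>v. u \<otimes> v) ` Units R = Units R" using assms(3) by blast
    then show ?thesis by simp
  qed
  moreover have "(\<lambda>v. (a \<otimes> u \<otimes> v, b \<otimes> u \<otimes> v)) ` Units R =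
      (\<lambda>v. (a \<otimes> v, b \<otimes> v)) ` (\<lambda>v. u \<otimes> v) ` Units R"
    unfolding image_image using assms by (intro image_cong) (simp_all add: m_assoc Units_closed)
  ultimately show ?thesis unfolding proj_pt_def Setcompr_eq_image by simp
qed

lemma proj_pt_self: "a \<in> carrier R \<Longrightarrow> b \<in> carrier R \<Longrightarrow> (a, b) \<in> proj_pt R a b"
  unfolding proj_pt_def using r_one Units_one_closed by force

lemma proj_pt_one_left_eq:
  assumes "r \<in> carrier R" "s \<in> carrier R"
  shows "proj_pt R \<one> r = proj_pt R \<one> s \<longleftrightarrow> r = s"
proof
  assume "proj_pt R \<one> r = proj_pt R \<one> s"
  then have "(\<one>, r) \<in> proj_pt R \<one> s" using proj_pt_self[of \<one> r] assms by simp
  then show "r = s" unfolding proj_pt_def using assms by (auto simp: Units_closed)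
qed simp

lemma proj_pt_one_right_eq:
  assumes "r \<in> carrier R" "s \<in> carrier R"
  shows "proj_pt R r \<one> = proj_pt R s \<one> \<longleftrightarrow> r = s"
proof
  assume "proj_pt R r \<one> = proj_pt R s \<one>"
  then have "(r, \<one>) \<in> proj_pt R s \<one>" using proj_pt_self[of r \<one>] assms by simp
  then show "r = s" unfolding proj_pt_def using assms by (auto simp: Units_closed)
qed simp

lemma proj_pt_left_neq_right:
  assumes "r \<in> carrier R" "m \<in> carrier R - Units R"
  shows "proj_pt R \<one> r \<noteq> proj_pt R m \<one>"
proof
  assume "proj_pt R \<one> r = proj_pt R m \<one>"
  then have "(\<one>, r) \<in> proj_pt R m \<one>" using proj_pt_self[of \<one> r] assms by simp
  then obtain u where "u \<in> Units R" "\<one> = m \<otimes> u" unfolding proj_pt_def by auto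
  then show False using nonunit_mult_closed[OF assms(2), of u] Units_closed Units_one_closed by auto
qed

text \<open>If two elements generate the ring, one of them is a unit, since otherwise 1 would be a
  sum of nonunits; scaling turns that coordinate into 1.\<close>

lemma proj_line_eq:
  "proj_line R = proj_pt R \<one> ` carrier R \<union> (\<lambda>m. proj_pt R m \<one>) ` (carrier R - Units R)"
proof (intro equalityI subsetI)
  fix P assume "P \<in> proj_line R"
  then obtain a b where ab: "P = proj_pt R a b" "a \<in> carrier R" "b \<in> carrier R"
    "PIdl a <+>\<^bsub>R\<^esub> PIdl b = carrier R"
    unfolding proj_line_def by blast
  show "P \<in> proj_pt R \<one> ` carrier R \<union> (\<lambda>m. proj_pt R m \<one>) ` (carrier R - Units R)"
  proof (cases "a \<in> Units R")
    case True
    then have "P = proj_pt R (a \<otimes> inv a) (b \<otimes> inv a)"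
      using ab proj_pt_scale[of a b "inv a"] by simp
    then show ?thesis using True ab by simp
  next
    case False
    have "\<one> \<in> PIdl a <+>\<^bsub>R\<^esub> PIdl b" using ab by simp
    then obtain x y where xy: "x \<in> carrier R" "y \<in> carrier R" "\<one> = x \<otimes> a \<oplus> y \<otimes> b"
      unfolding set_add_def' cgenideal_def by auto
    have "b \<in> Units R"
    proof (rule ccontr)
      assume "b \<notin> Units R"
      then have "a \<otimes> x \<oplus> b \<otimes> y \<in> carrier R - Units R"
        using False ab xy by (intro nonunit_add_closed nonunit_mult_closed) auto
      then show False using xy ab Units_one_closed by (simp add: m_comm)
    qed
    then have P: "P = proj_pt R (a \<otimes> inv b) \<one>" using ab proj_pt_scale[of a b "inv b"] by simp
    have "a \<otimes> inv b \<in> carrier R - Units R"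
      using nonunit_mult_closed[of a "inv b"] False ab \<open>b \<in> Units R\<close> by simp
    then show ?thesis using P by blast
  qed
next
  have one: "I <+>\<^bsub>R\<^esub> J = carrier R" if "ideal I R" "ideal J R" "\<one> \<in> I \<or> \<one> \<in> J" for I J
  proof -
    interpret IJ: ideal "I <+>\<^bsub>R\<^esub> J" R using add_ideals that by blast
    interpret I: ideal I R by fact
    interpret J: ideal J R by fact
    have "\<one> \<oplus> \<zero> \<in> I <+>\<^bsub>R\<^esub> J \<or> \<zero> \<oplus> \<one> \<in> I <+>\<^bsub>R\<^esub> J"
      unfolding set_add_def' using that(3) I.zero_closed J.zero_closed by blast
    then show ?thesis using IJ.one_imp_carrier by simp
  qed
  fix P assume "P \<in> proj_pt R \<one> ` carrier R \<union> (\<lambda>m. proj_pt R m \<one>) ` (carrier R - Units R)"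
  then obtain a b where "P = proj_pt R a b" "a \<in> carrier R" "b \<in> carrier R" "a = \<one> \<or> b = \<one>"
    by auto
  moreover from this have "PIdl a <+>\<^bsub>R\<^esub> PIdl b = carrier R"
    using one[of "PIdl a" "PIdl b"] cgenideal_ideal cgenideal_self by auto
  ultimately show "P \<in> proj_line R" unfolding proj_line_def by blast
qed

lemma proj_pt_in_line:
  "r \<in> carrier R \<Longrightarrow> proj_pt R \<one> r \<in> proj_line R"
  "m \<in> carrier R - Units R \<Longrightarrow> proj_pt R m \<one> \<in> proj_line R"
  by (auto simp: proj_line_eq)

section \<open>Equivalence of projective points and the action of matrices\<close>

lemma proj_simE:
  assumes "(P, Q) \<in> proj_sim R"
  obtains (left) r s where "r \<in> carrier R" "s \<in> carrier R" "r \<ominus> s \<in> carrier R - Units R"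
      "P = proj_pt R \<one> r" "Q = proj_pt R \<one> s"
  | (right) m n where "m \<in> carrier R - Units R" "n \<in> carrier R - Units R"
      "P = proj_pt R m \<one>" "Q = proj_pt R n \<one>"
  using assms unfolding proj_sim_def max_ideal_eq by blast

lemma proj_sim_left:
  assumes "r \<in> carrier R" "s \<in> carrier R"
  shows "(proj_pt R \<one> r, proj_pt R \<one> s) \<in> proj_sim R \<longleftrightarrow> r \<ominus> s \<in> carrier R - Units R"
proof
  assume "(proj_pt R \<one> r, proj_pt R \<one> s) \<in> proj_sim R"
  then show "r \<ominus> s \<in> carrier R - Units R"
    by (cases rule: proj_simE)
      (use assms in \<open>simp_all add: proj_pt_one_left_eq proj_pt_left_neq_right\<close>)
next
  assume "r \<ominus> s \<in> carrier R - Units R"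
  then show "(proj_pt R \<one> r, proj_pt R \<one> s) \<in> proj_sim R"
    using assms unfolding proj_sim_def max_ideal_eq by blast
qed

lemma proj_sim_right:
  "m \<in> carrier R - Units R \<Longrightarrow> n \<in> carrier R - Units R \<Longrightarrow>
    (proj_pt R m \<one>, proj_pt R n \<one>) \<in> proj_sim R"
  unfolding proj_sim_def max_ideal_eq by blast

lemma not_proj_sim_mixed:
  assumes "r \<in> carrier R" "m \<in> carrier R - Units R"
  shows "(proj_pt R \<one> r, proj_pt R m \<one>) \<notin> proj_sim R"
    "(proj_pt R m \<one>, proj_pt R \<one> r) \<notin> proj_sim R"
  using assms by (auto elim!: proj_simE dest: proj_pt_left_neq_right proj_pt_left_neq_right[symmetric])

text \<open>Multiplication by a matrix commutes with scaling by units, so any homogeneous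
  coordinates may be used, normalised or not.\<close>

lemma mat2_perm_proj_pt:
  assumes "x \<in> carrier R" "y \<in> carrier R" "proj_pt R x y \<in> proj_line R"
    "a \<in> carrier R" "b \<in> carrier R" "c \<in> carrier R" "d \<in> carrier R"
  shows "mat2_perm R a b c d (proj_pt R x y) =
    proj_pt R (x \<otimes> a \<oplus> y \<otimes> c) (x \<otimes> b \<oplus> y \<otimes> d)"
proof -
  have "x \<otimes> u \<otimes> a \<oplus> y \<otimes> u \<otimes> c = (x \<otimes> a \<oplus> y \<otimes> c) \<otimes> u"
    if "u \<in> carrier R" "a \<in> carrier R" "c \<in> carrier R" for u a c
    using assms(1,2) that by (simp add: l_distr r_distr m_ac)
  then have "(x \<otimes> u \<otimes> a \<oplus> y \<otimes> u \<otimes> c, x \<otimes> u \<otimes> b \<oplus> y \<otimes> u \<otimes> d) =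
      ((x \<otimes> a \<oplus> y \<otimes> c) \<otimes> u, (x \<otimes> b \<oplus> y \<otimes> d) \<otimes> u)" if "u \<in> Units R" for u
    using assms(4-7) that by (simp only: Units_closed)
  then show ?thesis
    using assms(3) unfolding mat2_perm_def proj_pt_def Setcompr_eq_image
    by (simp add: image_image)
qed

end

section \<open>The isomorphism with the projective local Moufang set\<close>

context special_abelian_moufang
begin

sublocale K: local_ring K
  by (intro local_ring.intro local_ring_axioms.intro cring_K ideal_nonunits_K)

lemmas proj_line_K = K.proj_line_eq[unfolded nonunits_K, unfolded K_fields]
lemmas proj_pt_in_line_K = K.proj_pt_in_line[unfolded nonunits_K, unfolded K_fields mem_Collect_eq]
lemmas proj_sim_left_K = K.proj_sim_left[unfolded nonunits_K, unfolded K_fields mem_Collect_eq]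
lemmas proj_sim_right_K = K.proj_sim_right[unfolded nonunits_K, unfolded K_fields mem_Collect_eq]
lemmas not_proj_sim_mixed_K =
  K.not_proj_sim_mixed[unfolded nonunits_K, unfolded K_fields mem_Collect_eq]
lemmas proj_pt_left_neq_right_K =
  K.proj_pt_left_neq_right[unfolded nonunits_K, unfolded K_fields mem_Collect_eq]
lemmas proj_pt_eq_K = K.proj_pt_one_left_eq[unfolded K_fields] K.proj_pt_one_right_eq[unfolded K_fields]
lemmas proj_pt_scale_K = K.proj_pt_scale[unfolded Units_K K_fields]
lemmas mat2_perm_proj_pt_K = K.mat2_perm_proj_pt[unfolded K_fields]

lemma e_carrier [simp]: "e \<in> R"
  using e_unit unit_carrier by blast

lemmas K_mult_simps [simp] = K.l_one[unfolded K_fields] K.r_one[unfolded K_fields]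
  K.l_null[unfolded K_fields] K.r_null[unfolded K_fields]
  K.minus_zero[unfolded K_fields] K.l_minus[unfolded K_fields] K.r_minus[unfolded K_fields]

section \<open>The bijection onto the projective line\<close>

lemma tau_nonunit: "x \<sim> Z \<Longrightarrow> \<tau> x \<sim> W" "x \<sim> W \<Longrightarrow> \<tau> x \<sim> Z"
  using lpgD(3)[OF mu_lpg[OF e_unit]] mu_Z[OF e_unit] mu_W[OF e_unit] pt0_in ptinf_in eqv_in
  by metis+

lemma tau_pt [simp]: "p \<in> points M \<Longrightarrow> \<tau> p \<in> points M"
  using lpg_app mu_lpg e_unit by blast

lemma tau_tau [simp]: "p \<in> points M \<Longrightarrow> \<tau> (\<tau> p) = p"
  using mu_mu e_unit by blast

text \<open>The second branch is [-m, 1] for x = m\<open>\<tau>\<close>, because then m =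
  x\<open>\<tau>\<close>.\<close>

definition proj_map :: "'a \<Rightarrow> ('a \<times> 'a) set"
  where "proj_map x = (if x \<in> R then proj_pt K e x else proj_pt K (\<^bold>~ \<tau> x) e)"

lemma proj_map_carrier: "x \<in> R \<Longrightarrow> proj_map x = proj_pt K e x"
  by (simp add: proj_map_def)

lemma proj_map_tau: "x \<sim> Z \<Longrightarrow> proj_map (\<tau> x) = proj_pt K (\<^bold>~ x) e"
  using tau_nonunit(1) eqv_in by (auto simp: proj_map_def carrier_iff)

lemma point_cases:
  assumes "p \<in> points M"
  obtains (carrier) "p \<in> R" | (tau) x where "x \<sim> Z" "x \<in> R" "p = \<tau> x"
proof (cases "p \<in> R")
  case False
  then have "\<tau> p \<sim> Z" using assms tau_nonunit(2) by (simp add: carrier_iff)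
  then show thesis using tau[of "\<tau> p"] assms nonunit_carrier by simp
qed (rule carrier)

lemma proj_map_sim:
  assumes "p \<in> points M" "q \<in> points M"
  shows "p \<sim> q \<longleftrightarrow> (proj_map p, proj_map q) \<in> proj_sim K"
  using assms(1)
proof (cases rule: point_cases)
  case carrier
  show ?thesis
    using assms(2)
  proof (cases rule: point_cases)
    case carrier': carrier
    with carrier show ?thesis by (simp add: proj_map_carrier proj_sim_left_K eqv_diff)
  next
    case (tau y)
    have "\<not> p \<sim> q"
      using carrier tau tau_nonunit(1)[OF tau(1)] eqv_trans unfolding carrier_iff by blast
    then show ?thesis
      using carrier tau nonunit_neg by (simp add: proj_map_carrier proj_map_tau not_proj_sim_mixed_K)
  qed
next
  case (tau x)
  show ?thesis
    using assms(2)
  proof (cases rule: point_cases)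
    case carrier
    have "\<not> p \<sim> q"
      using carrier tau tau_nonunit(1)[OF tau(1)] eqv_trans eqv_commute unfolding carrier_iff by blast
    then show ?thesis
      using carrier tau nonunit_neg by (simp add: proj_map_carrier proj_map_tau not_proj_sim_mixed_K)
  next
    case tau': (tau y)
    have "p \<sim> q"
      using tau tau' tau_nonunit(1) eqv_trans eqv_commute by blast
    then show ?thesis
      using tau tau' nonunit_neg by (simp add: proj_map_tau proj_sim_right_K)
  qed
qed

lemma proj_map_bij: "bij_betw proj_map (points M) (proj_line K)"
  unfolding bij_betw_def
proof
  show "inj_on proj_map (points M)"
  proof (rule inj_onI)
    fix p q assume pq: "p \<in> points M" "q \<in> points M" "proj_map p = proj_map q"
    show "p = q"
      using pq(1)
    proof (cases rule: point_cases)
      case carrier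
      from pq(2) show ?thesis
      proof (cases rule: point_cases)
        case (tau y)
        then show ?thesis
          using carrier pq(3) proj_pt_left_neq_right_K[of p "\<^bold>~ y"] nonunit_neg
          by (simp add: proj_map_carrier proj_map_tau)
      qed (use carrier pq(3) in \<open>simp add: proj_map_carrier proj_pt_eq_K\<close>)
    next
      case (tau x)
      from pq(2) show ?thesis
      proof (cases rule: point_cases)
        case carrier
        then show ?thesis
          using tau pq(3) proj_pt_left_neq_right_K[of q "\<^bold>~ x"] nonunit_neg
          by (simp add: proj_map_carrier proj_map_tau)
      next
        case tau': (tau y)
        then have "\<^bold>~ x = \<^bold>~ y" using tau pq(3) by (simp add: proj_map_tau proj_pt_eq_K)
        then have "x = y" using tau tau' K.minus_minus by (metis K_fields(1))
        then show ?thesis using tau tau' by simp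
      qed
    qed
  qed
  show "proj_map ` points M = proj_line K"
  proof (intro equalityI subsetI)
    fix P assume "P \<in> proj_map ` points M"
    then obtain p where p: "p \<in> points M" "P = proj_map p" by blast
    from p(1) show "P \<in> proj_line K"
      by (cases rule: point_cases)
        (use p(2) nonunit_neg in \<open>simp_all add: proj_map_carrier proj_map_tau proj_pt_in_line_K\<close>)
  next
    fix P assume "P \<in> proj_line K"
    then consider r where "r \<in> R" "P = proj_pt K e r" | m where "m \<sim> Z" "P = proj_pt K m e"
      unfolding proj_line_K by blast
    then show "P \<in> proj_map ` points M"
    proof cases
      case 1
      then show ?thesis using carrier_pt proj_map_carrier by (intro image_eqI[of _ _ r]) auto
    next
      case 2
      have "m \<in> R" "\<^bold>~ m \<sim> Z" using 2 nonunit_carrier nonunit_neg by auto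
      then show ?thesis
        using 2 carrier_pt proj_map_tau by (intro image_eqI[of _ _ "\<tau> (\<^bold>~ m)"]) auto
    qed
  qed
qed

sublocale P: eqv_bij proj_map "points M" "sim M" "proj_line K" "proj_sim K"
  by (intro eqv_bij.intro proj_map_bij proj_map_sim)

section \<open>Homogeneous coordinates and the matrix of \<open>\<tau>\<close>\<close>

lemma proj_map_repr:
  assumes "p \<in> points M"
  obtains a b where "a \<in> R" "b \<in> R" "proj_map p = proj_pt K a b"
  using assms
proof (cases rule: point_cases)
  case carrier
  then show ?thesis using that[of e p] proj_map_carrier by simp
next
  case (tau x)
  then show ?thesis using that[of "\<^bold>~ x" e] proj_map_tau by simp
qed

lemma proj_map_eq_line: "p \<in> points M \<Longrightarrow> proj_map p = proj_pt K a b \<Longrightarrow> proj_pt K a b \<in> proj_line K"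
  using P.\<phi>_in by metis

text \<open>On units this is the formula \<open>\<tau> x = -x\<inverse>\<close>.\<close>

lemma proj_map_tau_mat:
  assumes "p \<in> points M" "a \<in> R" "b \<in> R" "proj_map p = proj_pt K a b"
  shows "proj_map (\<tau> p) = proj_pt K (\<^bold>~ b) a"
proof -
  have mat: "mat2_perm K Z e (\<^bold>~ e) Z (proj_pt K a b) = proj_pt K (\<^bold>~ b) a"
    if "a \<in> R" "b \<in> R" "proj_pt K a b \<in> proj_line K" for a b
    using that by (simp add: mat2_perm_proj_pt_K)
  have "proj_map (\<tau> p) = mat2_perm K Z e (\<^bold>~ e) Z (proj_map p)"
    using assms(1)
  proof (cases rule: point_cases)
    case carrier
    have "proj_map (\<tau> p) = proj_pt K (\<^bold>~ p) e"
    proof (cases "p \<in> U")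
      case True
      have t: "\<tau> p \<in> R" using True mu_unit e_unit unit_carrier by blast
      have "proj_pt K (e \<^bold>* \<^bold>~ p) (\<tau> p \<^bold>* \<^bold>~ p) = proj_pt K e (\<tau> p)"
        using True t by (intro proj_pt_scale_K) auto
      then show ?thesis using True t mult_tau[OF True] carrier by (simp add: proj_map_carrier)
    next
      case False
      then show ?thesis using carrier proj_map_tau by (simp add: unit_iff)
    qed
    then show ?thesis
      using carrier mat[of e p] proj_pt_in_line_K(1) by (simp add: proj_map_carrier)
  next
    case (tau x)
    have "proj_pt K (\<^bold>~ e) (\<^bold>~ x) = proj_pt K (e \<^bold>* \<^bold>~ e) (x \<^bold>* \<^bold>~ e)" using tau by simp
    also have "\<dots> = proj_pt K e x" using tau e_unit by (intro proj_pt_scale_K) auto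
    finally show ?thesis
      using tau mat[of "\<^bold>~ x" e] proj_pt_in_line_K(2) nonunit_neg
      by (simp add: proj_map_carrier proj_map_tau carrier_pt)
  qed
  then show ?thesis using mat assms proj_map_eq_line by metis
qed

end

section \<open>The matrices of the root group elements\<close>

locale projective_moufang = special_abelian_moufang +
  assumes tau_alpha: "x \<sim> Z \<Longrightarrow> y \<in> R \<Longrightarrow> alpha M y (\<tau> x) =
    \<tau> (rmap M e x (\<tau> (alpha M (mneg M (madd M e e)) (rmap M e x y))))"
begin

text \<open>The right hand side of \<open>tau_alpha\<close> is \<open>\<tau> t\<close> with \<open>t = x (1 - x y)\<inverse>\<close>.\<close>

lemma proj_map_alpha_nonunit:
  assumes x: "x \<sim> Z" and y: "y \<in> R"
  shows "proj_map (alpha M y (\<tau> x)) = proj_pt K (\<^bold>~ x) (e \<^bold>- x \<^bold>* y)"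
proof -
  have xR: "x \<in> R" using x nonunit_carrier by blast
  define z where "z = x \<^bold>* y"
  \<comment> \<open>This is the inner part of \<open>tau_alpha\<close>, y R_x shifted by -2e. It
    equals -2(e - xy) and is a unit because xy is not.\<close>
  define w where "w = (z \<^bold>+ z) \<^bold>+ \<^bold>~ (e \<^bold>+ e)"
  have zN: "z \<sim> Z" and zR: "z \<in> R" unfolding z_def using x xR y nonunit_mult by auto
  have wU: "w \<in> U"
    unfolding w_def using twice_unit[OF e_unit] zN zR nonunit_add
    by (subst K.a_comm) (auto intro!: unit_add_nonunit)
  then have wR: "w \<in> R" "\<tau> w \<in> R" using unit_carrier mu_unit e_unit by auto
  have "rmap M e x y = z \<^bold>+ z"
    unfolding z_def using mult_twice[OF y xR] mult_comm[OF xR y] by simp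
  then have "alpha M (mneg M (madd M e e)) (rmap M e x y) = w"
    using zR by (simp add: alpha_K madd_K w_def)
  define t where "t = rmap M e x (\<tau> w)"
  have t2: "t = x \<^bold>* \<tau> w \<^bold>+ x \<^bold>* \<tau> w"
    unfolding t_def using mult_twice[OF wR(2) xR] mult_comm[OF xR wR(2)] by simp
  have tN: "t \<sim> Z" and tR: "t \<in> R"
    unfolding t2 using x xR wR nonunit_mult nonunit_add by auto
  have u: "e \<^bold>- z \<in> U"
    using unit_add_nonunit[OF e_unit nonunit_neg[OF zN]] by (simp add: K_minus_def)
  \<comment> \<open>Computes 2t(e - z): first 2(e - z) is -w, and then t =
    2x(w\<open>\<tau>\<close>) with (w\<open>\<tau>\<close>)w = -e gives 2x.\<close>
  have "(t \<^bold>* (e \<^bold>- z)) \<^bold>+ (t \<^bold>* (e \<^bold>- z)) = t \<^bold>* \<^bold>~ w"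
  proof -
    have "\<^bold>~ w = (e \<^bold>- z) \<^bold>+ (e \<^bold>- z)"
      unfolding w_def using zR by (simp add: K_minus_def K_minus_add K_ac)
    then show ?thesis using tR u unit_carrier by (simp add: K.r_distr)
  qed
  also have "\<dots> = x \<^bold>+ x"
    unfolding t2 using xR wR mult_tau[OF wU] by (simp add: K.l_distr K.m_assoc K_minus_add)
  finally have tx: "t \<^bold>* (e \<^bold>- z) = x"
    using twice_cancel[of "t \<^bold>* (e \<^bold>- z)" x] tR xR u unit_carrier by simp
  have "alpha M y (\<tau> x) = \<tau> t"
    using tau_alpha[OF x y] \<open>alpha M _ _ = w\<close> by (simp add: t_def)
  then have "proj_map (alpha M y (\<tau> x)) = proj_pt K (\<^bold>~ t) e"
    using proj_map_tau[OF tN] by simp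
  also have "\<dots> = proj_pt K (\<^bold>~ t \<^bold>* (e \<^bold>- z)) (e \<^bold>* (e \<^bold>- z))"
    using proj_pt_scale_K[of "\<^bold>~ t" e "e \<^bold>- z"] tR u by simp
  also have "\<dots> = proj_pt K (\<^bold>~ x) (e \<^bold>- z)"
    using tx tR u zR by simp
  finally show ?thesis by (simp add: z_def)
qed

lemma proj_map_alpha_mat:
  assumes "p \<in> points M" "a \<in> R" "b \<in> R" "proj_map p = proj_pt K a b" and y: "y \<in> R"
  shows "proj_map (alpha M y p) = proj_pt K a (a \<^bold>* y \<^bold>+ b)"
proof -
  have mat: "mat2_perm K e y Z e (proj_pt K a b) = proj_pt K a (a \<^bold>* y \<^bold>+ b)"
    if "a \<in> R" "b \<in> R" "proj_pt K a b \<in> proj_line K" for a b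
    using that y by (simp add: mat2_perm_proj_pt_K)
  \<comment> \<open>The right-hand side does not mention a and b, so checking normalised coordinates
    is enough; \<open>mat\<close> evaluates it at the given pair afterwards.\<close>
  have "proj_map (alpha M y p) = mat2_perm K e y Z e (proj_map p)"
    using assms(1)
  proof (cases rule: point_cases)
    case carrier
    then show ?thesis
      using y mat[of e p] proj_pt_in_line_K(1)
      by (simp add: alpha_K proj_map_carrier K.a_comm[of p])
  next
    case (tau x)
    then show ?thesis
      using y mat[of "\<^bold>~ x" e] proj_pt_in_line_K(2) nonunit_neg
      by (simp add: proj_map_alpha_nonunit proj_map_tau K_minus_def K.a_comm[of e])
  qed
  then show ?thesis using mat assms proj_map_eq_line by metis
qed

lemma transport_alpha:
  assumes y: "y \<in> R" shows "P.transport (alpha M y) = mat2_perm K e y Z e"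
proof (rule P.transport_eqI)
  fix p assume p: "p \<in> points M"
  then obtain a b where ab: "a \<in> R" "b \<in> R" "proj_map p = proj_pt K a b" by (rule proj_map_repr)
  then show "mat2_perm K e y Z e (proj_map p) = proj_map (alpha M y p)"
    using proj_map_alpha_mat[OF p ab y] proj_map_eq_line[OF p] y
    by (simp add: mat2_perm_proj_pt_K)
qed (simp add: mat2_perm_def)

text \<open>The element of U_0 taking infinity to y\<open>\<tau>\<close> is the conjugate of alpha_y
  by \<open>\<tau>\<close>. Conjugating the matrix of alpha_y by that of \<open>\<tau>\<close>
  produces the lower unitriangular matrix with entry -y.\<close>

lemma transport_gamma:
  assumes y: "y \<in> R" shows "P.transport (gamma (\<tau> y)) = mat2_perm K e Z (\<^bold>~ y) e"
proof (rule P.transport_eqI)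
  fix q assume "q \<in> points M"
  then obtain p where p: "p \<in> points M" "q = \<tau> p" using tau_tau tau_pt by metis
  obtain a b where ab: "a \<in> R" "b \<in> R" "proj_map p = proj_pt K a b"
    using p(1) by (rule proj_map_repr)
  have q: "proj_map q = proj_pt K (\<^bold>~ b) a"
    using proj_map_tau_mat[OF p(1) ab] p(2) by simp
  have ap: "alpha M y p \<in> points M" using lpg_app[OF alpha_lpg[OF y] p(1)] .
  have "proj_map (gamma (\<tau> y) q) = proj_map (\<tau> (alpha M y p))"
    using mu_alpha[OF e_unit y p(1)] p(2) by simp
  also have "\<dots> = proj_pt K (\<^bold>~ (a \<^bold>* y \<^bold>+ b)) a"
    using proj_map_tau_mat[OF ap _ _ proj_map_alpha_mat[OF p(1) ab y]] ab y by simp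
  also have "\<dots> = mat2_perm K e Z (\<^bold>~ y) e (proj_map q)"
    using proj_map_eq_line[OF _ q] p ab y unfolding q
    by (simp add: mat2_perm_proj_pt_K K_minus_add K.a_comm)
  finally show "mat2_perm K e Z (\<^bold>~ y) e (proj_map q) = proj_map (gamma (\<tau> y) q)" by simp
qed (simp add: mat2_perm_def)

lemma transport_root_W: "P.transport ` root_group M W = proj_upper K"
proof -
  have "root_group M W = alpha M ` R"
  proof (intro equalityI subsetI)
    fix u assume u: "u \<in> root_group M W"
    have "u Z \<in> R"
      using fix_carrier[OF root_lpg[OF ptinf_in u] LM2_fix[OF ptinf_in u]] by simp
    then show "u \<in> alpha M ` R" using alpha_eqI[OF _ u] by force
  qed (use alpha in auto)
  then show ?thesis
    unfolding proj_upper_def by (auto simp: image_image transport_alpha Setcompr_eq_image)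
qed

text \<open>An element of U_0 is determined by its image of infinity, a point y\<open>\<tau>\<close>
  with y in R. Negation permutes R, so the sign in \<open>transport_gamma\<close>
  disappears.\<close>

lemma transport_root_Z: "P.transport ` root_group M Z = proj_lower K"
proof -
  have "root_group M Z = (\<lambda>y. gamma (\<tau> y)) ` R"
  proof (intro equalityI subsetI)
    fix u assume u: "u \<in> root_group M Z"
    note uZ = LM2_fix[OF pt0_in u] and ul = root_lpg[OF pt0_in u]
    have uW: "u W \<in> points M" "\<not> u W \<sim> Z"
      using lpg_app[OF ul ptinf_in] lpgD(3)[OF ul ptinf_in pt0_in] uZ by simp_all
    then have "\<tau> (u W) \<in> R"
      using tau_nonunit(1)[of "\<tau> (u W)"] lpgD(3)[OF mu_lpg[OF e_unit] _ pt0_in] mu_Z[OF e_unit]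
      by (simp add: carrier_iff)
    moreover have "u = gamma (\<tau> (\<tau> (u W)))" using gamma_eqI[OF uW u] uW by simp
    ultimately show "u \<in> (\<lambda>y. gamma (\<tau> y)) ` R" by blast
  qed (use gamma mu_not_eqv_Z e_unit in auto)
  then have "P.transport ` root_group M Z = (\<lambda>y. mat2_perm K e Z (\<^bold>~ y) e) ` R"
    by (simp add: image_image transport_gamma)
  also have "\<dots> = (\<lambda>r. mat2_perm K e Z r e) ` (\<lambda>y. \<^bold>~ y) ` R" by (simp add: image_image)
  also have "(\<lambda>y. \<^bold>~ y) ` R = R"
  proof -
    have "y \<in> (\<lambda>y. \<^bold>~ y) ` R" if "y \<in> R" for y
      using that by (intro image_eqI[of _ _ "\<^bold>~ y"]) auto
    then show ?thesis by auto
  qed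
  finally show ?thesis unfolding proj_lower_def by (auto simp: Setcompr_eq_image)
qed

section \<open>Matching all root groups\<close>

lemma proj_map_Z: "proj_map Z = proj_pt K e Z"
  by (simp add: proj_map_carrier)

lemma proj_map_W: "proj_map W = proj_pt K Z e"
  using proj_map_tau[of Z] mu_Z[OF e_unit] pt0_in by simp

text \<open>\<open>proj_root_group\<close> refers to the unique upper or lower element with a
  prescribed value; this resolves these descriptions to transports of alpha_x and gamma_x.\<close>

lemma transport_the:
  assumes S: "S \<subseteq> carrier (symg M)" and g: "g \<in> S" "g p = x" and p: "p \<in> points M"
    and uniq: "\<And>u. u \<in> S \<Longrightarrow> u p = x \<Longrightarrow> u = g"
  shows "(THE f. f \<in> P.transport ` S \<and> f (proj_map p) = proj_map x) = P.transport g"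
proof (rule the_equality)
  show "P.transport g \<in> P.transport ` S \<and> P.transport g (proj_map p) = proj_map x"
    using g p P.transport_app by simp
  fix f assume "f \<in> P.transport ` S \<and> f (proj_map p) = proj_map x"
  then obtain u where u: "u \<in> S" "f = P.transport u" "proj_map (u p) = proj_map x"
    using P.transport_app p by auto
  then have "u p = x"
    using P.\<phi>_eq_iff eqv_sym_carrierD(3)[OF subsetD[OF S] p] g by metis
  then show "f = P.transport g" using uniq u by blast
qed

text \<open>By (LM3), U_x is the conjugate of U_0 by alpha_x, or of U_infinity by gamma_x when x is
  equivalent to infinity. Transport matches this with the two cases of
  \<open>proj_root_group\<close>.\<close>

lemma transport_root_group:
  assumes x: "x \<in> points M"
  shows "P.transport ` root_group M x = proj_root_group K (proj_map x)"
proof (cases "x \<sim> W")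
  case False
  then have xR: "x \<in> R" using x by (simp add: carrier_iff)
  have "(THE g. g \<in> proj_upper K \<and> g (proj_map Z) = proj_map x) = P.transport (alpha M x)"
    unfolding transport_root_W[symmetric]
    by (rule transport_the[OF _ alpha[OF xR] pt0_in])
      (simp_all add: root_carrier[OF ptinf_in] alpha_eqI[OF xR] subsetI)
  moreover have "root_group M x = conj_set (symg M) (root_group M Z) (alpha M x)"
    using LM3[OF pt0_in alpha_lpg[OF xR]] alpha(2)[OF xR] by simp
  moreover have "root_group M Z \<subseteq> carrier (symg M)" using root_carrier[OF pt0_in] by blast
  ultimately show ?thesis
    using False proj_map_sim[OF x ptinf_in] lpg_carrier[OF alpha_lpg[OF xR]]
    unfolding proj_root_group_def Let_def proj_map_W proj_map_Z K_fields
    by (simp add: P.transport_conj_set transport_root_Z)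
next
  case True
  then have xZ: "\<not> x \<sim> Z" using eqv_commute eqv_trans not_eqv by blast
  have "(THE g. g \<in> proj_lower K \<and> g (proj_map W) = proj_map x) = P.transport (gamma x)"
    unfolding transport_root_Z[symmetric]
    by (rule transport_the[OF _ gamma[OF x xZ] ptinf_in])
      (simp_all add: root_carrier[OF pt0_in] gamma_eqI[OF x xZ] subsetI)
  moreover have "root_group M x = conj_set (symg M) (root_group M W) (gamma x)"
    using LM3[OF ptinf_in gamma_lpg[OF x xZ]] gamma(2)[OF x xZ] by simp
  moreover have "root_group M W \<subseteq> carrier (symg M)" using root_carrier[OF ptinf_in] by blast
  ultimately show ?thesis
    using True proj_map_sim[OF x ptinf_in] lpg_carrier[OF gamma_lpg[OF x xZ]]
    unfolding proj_root_group_def Let_def proj_map_W proj_map_Z K_fields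
    by (simp add: P.transport_conj_set transport_root_W)
qed

text \<open>Each theta_x is the same conjugation by \<open>proj_map\<close>, restricted to U_x, so
  compatibility with the actions is immediate.\<close>

lemma moufang_isomorphic_proj: "moufang_isomorphic M (proj_moufang K)"
  unfolding moufang_isomorphic_def
proof (intro exI[of _ proj_map] exI[of _ "\<lambda>_. P.transport"] conjI ballI)
  show "bij_betw proj_map (points M) (points (proj_moufang K))"
    using proj_map_bij by (simp add: proj_moufang_def)
  fix x assume x: "x \<in> points M"
  have "root_group M x \<subseteq> carrier (symg M)" using root_carrier[OF x] by blast
  then show "P.transport \<in> iso (symg M\<lparr>carrier := root_group M x\<rparr>)
      (symg (proj_moufang K)\<lparr>carrier := root_group (proj_moufang K) (proj_map x)\<rparr>)"
    using transport_root_group[OF x]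
    unfolding iso_def hom_def bij_betw_def inj_on_def proj_moufang_def
    by (auto simp: P.transport_mult intro: P.transport_inj)
  fix y assume "y \<in> points M"
  then show "x \<sim> y \<longleftrightarrow> (proj_map x, proj_map y) \<in> sim (proj_moufang K)"
    using proj_map_sim x by (simp add: proj_moufang_def)
  show "proj_map (u x) = P.transport u (proj_map x)" for u
    using P.transport_app x by simp
qed

end

theorem theorem5p20:
  fixes M :: "'a pointed_moufang" and e :: 'a
  assumes "pointed_local_moufang_set M"
    and R1: "special M"
    and R2: "comm_group (symg M \<lparr>carrier := root_group M (ptinf M)\<rparr>)"
    and R3: "comm_group (symg M \<lparr>carrier := hua_subgroup M\<rparr>)"
    and R4: "\<forall>x\<in>munits M. mdouble M x \<in> munits M"
    and e: "e \<in> munits M"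
    and "\<forall>x y. (x, pt0 M) \<in> sim M \<and> y \<in> points M \<and> (y, ptinf M) \<notin> sim M \<longrightarrow>
      x \<triangleleft> mu M e \<triangleleft> alpha M y =
      y \<triangleleft> rmap M e x \<triangleleft> alpha M (mneg M (madd M e e)) \<triangleleft> mu M e \<triangleleft> rmap M e x \<triangleleft> mu M e"
  shows "moufang_isomorphic M (proj_moufang (mring M e))"
proof -
  interpret pointed_local_moufang_set M by fact
  interpret projective_moufang M e
    by (intro projective_moufang.intro projective_moufang_axioms.intro
        special_abelian_moufang.intro special_abelian_moufang_axioms.intro)
      (use assms carrier_iff in blast)+
  show ?thesis by (rule moufang_isomorphic_proj)
qed

end
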